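(* Suppose that $\Phi=\{\varphi_n\}_{n\in\mathbb{Z}_+}$ is a complete orthonormal basis of the Sobolev-type space $\mathcal{H}_v$ on $\mathbb{R}$ with respect to the inner product $\langle\cdot,\cdot\rangle_v$ and is orthogonal with respect to $\langle\!\langle\cdot,\cdot\rangle\!\rangle_V$, that is, $$\langle\varphi_m,\varphi_n\rangle_v=\delta_{m,n},\qquad \langle\!\langle\varphi_m,\varphi_n\rangle\!\rangle_V=\lambda_m\delta_{m,n},\qquad m,n\in\mathbb{Z}_+.$$ Then, for each $m\in\mathbb{Z}_+$, $\lambda_m$ is an eigenvalue and $\varphi_m$ a corresponding eigenfunction of $$-y''+Vy=\lambda\sum_{k=0}^\infty(-1)^k v_k\,y^{(2k)},\qquad x\in\mathbb{R},$$ with Cauchy boundary conditions.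
   Context: $\mathbb{Z}_+=\{0,1,2,\ldots\}$. Let $v_k\ge 0$ for $k\in\mathbb{Z}_+$ be such that $v(x)=\sum_{k=0}^\infty v_k x^{2k}>0$ for $x\in\mathbb{R}$. Define $$\langle f,g\rangle_v=\sum_{k=0}^\infty v_k\int_{-\infty}^\infty f^{(k)}(x)\overline{g^{(k)}(x)}\,dx,$$ and let $\mathcal{H}_v$ be the Hilbert space of functions $f$ on $\mathbb{R}$ with $\langle f,f\rangle_v<\infty$ ($v\equiv1$ gives $L_2(\mathbb{R})$, $v(x)=1+x^2$ gives $H^1(\mathbb{R})$). For a (sufficiently regular) potential $V:\mathbb{R}\to\mathbb{R}$, $$\langle\!\langle f,g\rangle\!\rangle_V=\int_{-\infty}^\infty\left[V(x)f(x)\overline{g(x)}+f'(x)\overline{g'(x)}\right]dx.$$ The basis functions $\varphi_n$ are infinitely differentiable. "Cauchy boundary conditions" refers to the problem on the whole real line, where functions and their derivatives decay at $\pm\infty$, so that no boundary terms arise when integrating by parts.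
   Formalization: V is taken continuous; it is also assumed that each −φₙ''+Vφₙ lies in L₂(ℝ) (the claim can fail otherwise, even for v≡1, V=x²) and that Σ(−1)^k v_k φₙ^{(2k)} converges locally uniformly, so that the right-hand side makes sense; the φₙ and all their derivatives decay at ±∞. *)

theory Defs
  imports "HOL-Analysis.Analysis"
begin

definition nth_deriv :: "nat \<Rightarrow> (real \<Rightarrow> complex) \<Rightarrow> real \<Rightarrow> complex" where
  "nth_deriv k = (\<lambda>f x. vector_derivative f (at x)) ^^ k"

definition smooth :: "(real \<Rightarrow> complex) \<Rightarrow> bool" where
  "smooth f \<longleftrightarrow> (\<forall>k x. nth_deriv k f differentiable (at x))"

(* The boundary conditions at -infinity and +infinity: f and all its derivatives decay. *)
definition cauchy_bc :: "(real \<Rightarrow> complex) \<Rightarrow> bool" where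
  "cauchy_bc f \<longleftrightarrow> (\<forall>k. (nth_deriv k f \<longlongrightarrow> 0) at_top \<and> (nth_deriv k f \<longlongrightarrow> 0) at_bot)"

definition square_integrable :: "(real \<Rightarrow> complex) \<Rightarrow> bool" where
  "square_integrable f \<longleftrightarrow>
     f \<in> borel_measurable lebesgue \<and> integrable lebesgue (\<lambda>x. (norm (f x))\<^sup>2)"

(* f has a k-th derivative in the Sobolev sense.  On the line this means that f, f', ..., f^(k-1)
   are locally absolutely continuous, i.e. each is the indefinite Lebesgue integral of the next.
   For j + 1 < k the integrand is continuous, so these derivatives exist at every point; f^(k)
   exists almost everywhere.  The unspecified values of vector_derivative at the remaining null
   set do not affect square_integrable (nth_deriv k f) or sobolev_inner. *)
definition has_sobolev_deriv :: "nat \<Rightarrow> (real \<Rightarrow> complex) \<Rightarrow> bool" where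
  "has_sobolev_deriv k f \<longleftrightarrow>
     (\<forall>j<k. \<forall>a b. a \<le> b \<longrightarrow>
        nth_deriv (Suc j) f absolutely_integrable_on {a..b} \<and>
        (nth_deriv (Suc j) f has_integral (nth_deriv j f b - nth_deriv j f a)) {a..b})"

definition sobolev_inner :: "(nat \<Rightarrow> real) \<Rightarrow> (real \<Rightarrow> complex) \<Rightarrow> (real \<Rightarrow> complex) \<Rightarrow> complex" where
  "sobolev_inner v f g =
     (\<Sum>k. of_real (v k) * (LINT x|lebesgue. nth_deriv k f x * cnj (nth_deriv k g x)))"

(* The space of f with finite sobolev_inner v f f.  As 0 * infinity = 0 here, nothing is required
   of the derivatives of order k if v k = 0 (beyond what higher orders force).  Membership is
   stated for functions, not for their classes modulo null sets: a class belongs to the space iff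
   it has such a representative. *)
definition sobolev_space :: "(nat \<Rightarrow> real) \<Rightarrow> (real \<Rightarrow> complex) set" where
  "sobolev_space v =
     {f. (\<forall>k. v k \<noteq> 0 \<longrightarrow> has_sobolev_deriv k f \<and> square_integrable (nth_deriv k f)) \<and>
         summable (\<lambda>k. v k * (LINT x|lebesgue. (norm (nth_deriv k f x))\<^sup>2))}"

definition sobolev_norm :: "(nat \<Rightarrow> real) \<Rightarrow> (real \<Rightarrow> complex) \<Rightarrow> real" where
  "sobolev_norm v f = sqrt (Re (sobolev_inner v f f))"

definition complete_orthonormal_basis ::
    "(nat \<Rightarrow> real) \<Rightarrow> (nat \<Rightarrow> real \<Rightarrow> complex) \<Rightarrow> bool" where
  "complete_orthonormal_basis v \<phi> \<longleftrightarrow>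
     (\<forall>n. \<phi> n \<in> sobolev_space v) \<and>
     (\<forall>m n. sobolev_inner v (\<phi> m) (\<phi> n) = (if m = n then 1 else 0)) \<and>
     (\<forall>f\<in>sobolev_space v. \<forall>e>0. \<exists>N c.
        sobolev_norm v (\<lambda>x. f x - (\<Sum>n<N. c n * \<phi> n x)) < e)"

definition schroedinger_integrand ::
    "(real \<Rightarrow> real) \<Rightarrow> (real \<Rightarrow> complex) \<Rightarrow> (real \<Rightarrow> complex) \<Rightarrow> real \<Rightarrow> complex" where
  "schroedinger_integrand V f g x =
     of_real (V x) * f x * cnj (g x) + nth_deriv 1 f x * cnj (nth_deriv 1 g x)"

definition schroedinger_form ::
    "(real \<Rightarrow> real) \<Rightarrow> (real \<Rightarrow> complex) \<Rightarrow> (real \<Rightarrow> complex) \<Rightarrow> complex" where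
  "schroedinger_form V f g = (LINT x|lebesgue. schroedinger_integrand V f g x)"

definition schroedinger_op :: "(real \<Rightarrow> real) \<Rightarrow> (real \<Rightarrow> complex) \<Rightarrow> real \<Rightarrow> complex" where
  "schroedinger_op V y x = - nth_deriv 2 y x + of_real (V x) * y x"

definition sobolev_op_term :: "(nat \<Rightarrow> real) \<Rightarrow> (real \<Rightarrow> complex) \<Rightarrow> nat \<Rightarrow> real \<Rightarrow> complex" where
  "sobolev_op_term v y k x = (-1) ^ k * of_real (v k) * nth_deriv (2 * k) y x"

definition is_eigenfunction ::
    "(nat \<Rightarrow> real) \<Rightarrow> (real \<Rightarrow> real) \<Rightarrow> complex \<Rightarrow> (real \<Rightarrow> complex) \<Rightarrow> bool" where
  "is_eigenfunction v V l y \<longleftrightarrow>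
     (\<exists>x. y x \<noteq> 0) \<and> smooth y \<and> cauchy_bc y \<and>
     (\<forall>x. summable (\<lambda>k. sobolev_op_term v y k x) \<and>
          schroedinger_op V y x = l * (\<Sum>k. sobolev_op_term v y k x))"

definition is_eigenvalue :: "(nat \<Rightarrow> real) \<Rightarrow> (real \<Rightarrow> real) \<Rightarrow> complex \<Rightarrow> bool" where
  "is_eigenvalue v V l \<longleftrightarrow> (\<exists>y. is_eigenfunction v V l y)"

end

theory Submission
  imports Defs
begin

text \<open>
  Write \<open>G = - \<phi>\<^sub>m'' + V \<phi>\<^sub>m\<close>. Integration by parts gives \<open>\<integral> G cnj \<phi>\<^sub>n = \<lambda>\<^sub>m \<delta>\<^sub>m\<^sub>n\<close>, hence by completeness
  \<open>\<integral> G cnj f = \<lambda>\<^sub>m \<langle>\<phi>\<^sub>m, f\<rangle>\<^sub>v\<close> for every smooth \<open>f\<close> in the Sobolev space. That space may contain no compactly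
  supported function but \<open>0\<close>, so the test functions are the translates and dilates \<open>\<kappa>\<^sub>t (x - y)\<close> of a Fejer kernel,
  whose derivatives grow only geometrically. For them the equation reads
  \<open>G * \<kappa>\<^sub>t = \<lambda>\<^sub>m lim P\<^sub>N * \<kappa>\<^sub>t\<close>, where \<open>P\<^sub>N\<close> is the partial sum of \<open>\<Sum> (-1)\<^sup>k v\<^sub>k \<phi>\<^sub>m\<^sup>(\<^sup>2\<^sup>k\<^sup>)\<close>.

  Since \<open>P\<^sub>N\<close> is only known to converge locally, its tails must be controlled before the limit can be
  moved inside the convolution. The terms of \<open>P\<^sub>N * \<kappa>\<^sub>t\<close> have pairwise nonnegative inner products, as is seen by
  integrating by parts, so the \<open>L\<^sup>2\<close> norm of \<open>P\<^sub>N * \<kappa>\<^sub>t\<close> increases with \<open>N\<close> and is at most that of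
  \<open>\<lambda>\<^sub>m\<^sup>-\<^sup>1 G * \<kappa>\<^sub>t\<close>. As \<open>t\<close> grows, this bounds \<open>P\<^sub>N\<close> in \<open>L\<^sup>2\<close>; the limits then commute, and letting the kernel
  shrink to a point gives the equation pointwise. If \<open>\<lambda>\<^sub>m = 0\<close>, then \<open>G * \<kappa>\<^sub>t = 0\<close> and \<open>G = 0\<close>.
\<close>

subsection \<open>Smooth and square-integrable functions\<close>

lemma nth_deriv_0 [simp]: "nth_deriv 0 f = f"
  by (simp add: nth_deriv_def)

lemma nth_deriv_Suc: "nth_deriv (Suc k) f = (\<lambda>x. vector_derivative (nth_deriv k f) (at x))"
  by (simp add: nth_deriv_def)

lemma smooth_has_vector_derivative:
  assumes "smooth f"
  shows "(nth_deriv k f has_vector_derivative nth_deriv (Suc k) f x) (at x)"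
  using assms unfolding smooth_def nth_deriv_Suc by (simp add: vector_derivative_works)

lemma smooth_continuous_on: "smooth f \<Longrightarrow> continuous_on A (nth_deriv k f)"
  by (meson continuous_at_imp_continuous_on has_vector_derivative_continuous smooth_has_vector_derivative)

lemma nth_deriv_eqI:
  assumes "F 0 = f" "\<And>k x. (F k has_vector_derivative F (Suc k) x) (at x)"
  shows "nth_deriv k f = F k"
proof (induction k)
  case (Suc k)
  then show ?case
    using assms(2) by (auto simp: nth_deriv_Suc vector_derivative_at)
qed (use assms(1) in simp)

lemma smoothI:
  assumes "F 0 = f" "\<And>k x. (F k has_vector_derivative F (Suc k) x) (at x)"
  shows "smooth f"
  unfolding smooth_def nth_deriv_eqI[of F, OF assms] using assms(2) differentiableI_vector by blast

text \<open>Only the form \<open>f - c * g\<close> is treated, here and later for \<open>l2\<close>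
  and \<open>sobolev_space\<close>, because the remainders
  \<open>f x - (\<Sum>n<N. c n * \<phi> n x)\<close> of a basis expansion arise by repeating
  it.\<close>

lemma
  assumes "smooth f" "smooth g"
  shows smooth_diff_scale: "smooth (\<lambda>x. f x - c * g x)"
    and nth_deriv_diff_scale:
      "nth_deriv k (\<lambda>x. f x - c * g x) = (\<lambda>x. nth_deriv k f x - c * nth_deriv k g x)"
proof -
  have *: "((\<lambda>x. nth_deriv k f x - c * nth_deriv k g x) has_vector_derivative
        nth_deriv (Suc k) f x - c * nth_deriv (Suc k) g x) (at x)" for k x
    by (intro derivative_intros smooth_has_vector_derivative assms)
  show "smooth (\<lambda>x. f x - c * g x)"
    by (rule smoothI[where F = "\<lambda>k x. nth_deriv k f x - c * nth_deriv k g x"]) (use * in auto)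
  show "nth_deriv k (\<lambda>x. f x - c * g x) = (\<lambda>x. nth_deriv k f x - c * nth_deriv k g x)"
    by (rule nth_deriv_eqI[where F = "\<lambda>k x. nth_deriv k f x - c * nth_deriv k g x"]) (use * in auto)
qed

lemma smooth_has_sobolev_deriv:
  assumes "smooth f" shows "has_sobolev_deriv k f"
  unfolding has_sobolev_deriv_def
proof (intro allI impI conjI)
  fix j a b :: real and i assume "a \<le> b"
  show "nth_deriv (Suc i) f absolutely_integrable_on {a..b}"
    using absolutely_integrable_continuous[of a b "nth_deriv (Suc i) f"] smooth_continuous_on[OF assms]
    by simp
  show "(nth_deriv (Suc i) f has_integral nth_deriv i f b - nth_deriv i f a) {a..b}"
    by (intro fundamental_theorem_of_calculus \<open>a \<le> b\<close>)
       (auto intro: has_vector_derivative_at_within smooth_has_vector_derivative[OF assms])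
qed

text \<open>Square integrability over \<open>lborel\<close>, where Fubini and affine substitution
  are applied. The passage from \<open>lebesgue\<close> is made for continuous functions, where both
  notions agree.\<close>

definition l2 :: "(real \<Rightarrow> complex) \<Rightarrow> bool" where
  "l2 f \<longleftrightarrow> f \<in> borel_measurable borel \<and> integrable lborel (\<lambda>x. (norm (f x))\<^sup>2)"

lemma borel_measurable_continuous: "continuous_on UNIV f \<Longrightarrow> f \<in> borel_measurable borel"
  by (rule borel_measurable_continuous_onI)

lemma square_integrable_iff_l2:
  assumes "continuous_on UNIV f"
  shows "square_integrable f \<longleftrightarrow> l2 f"
proof -
  have [measurable]: "f \<in> borel_measurable borel"
    using assms by (rule borel_measurable_continuous)
  show ?thesis
    unfolding square_integrable_def l2_def
    by (auto simp: integrable_completion measurable_completion)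
qed

lemma lebesgue_integral_eq_lborel:
  assumes "continuous_on UNIV (f :: real \<Rightarrow> 'a :: {banach, second_countable_topology})"
  shows "(LINT x|lebesgue. f x) = (LINT x|lborel. f x)"
  using borel_measurable_continuous_onI[OF assms] by (simp add: integral_completion)

lemma lebesgue_integrable_iff_lborel:
  assumes "continuous_on UNIV (f :: real \<Rightarrow> 'a :: {banach, second_countable_topology})"
  shows "integrable lebesgue f \<longleftrightarrow> integrable lborel f"
  using borel_measurable_continuous_onI[OF assms] by (simp add: integrable_completion)

text \<open>Serves as Cauchy-Schwarz with a free weight: when \<open>b\<close> is of size
  \<open>e\<close>, both summands on the right are of order \<open>e\<close>, and no square roots of
  integrals are needed.\<close>

lemma two_mult_le_weighted_squares:
  fixes a b e :: real assumes "e > 0"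
  shows "2 * (a * b) \<le> e * a\<^sup>2 + b\<^sup>2 / e"
proof -
  have "0 \<le> (e * a - b)\<^sup>2 / e" using assms by simp
  also have "\<dots> = e * a\<^sup>2 + b\<^sup>2 / e - 2 * (a * b)"
    using assms by (simp add: power2_eq_square field_simps)
  finally show ?thesis by simp
qed

lemma l2_mult_integrable:
  assumes "l2 f" "l2 g"
  shows "integrable lborel (\<lambda>x. f x * g x)"
proof (rule Bochner_Integration.integrable_bound)
  show "integrable lborel (\<lambda>x. (norm (f x))\<^sup>2 + (norm (g x))\<^sup>2)"
    using assms by (auto simp: l2_def)
  show "(\<lambda>x. f x * g x) \<in> borel_measurable lborel"
    using assms by (auto simp: l2_def)
  show "AE x in lborel. norm (f x * g x) \<le> norm ((norm (f x))\<^sup>2 + (norm (g x))\<^sup>2)"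
  proof (rule AE_I2)
    fix x
    show "norm (f x * g x) \<le> norm ((norm (f x))\<^sup>2 + (norm (g x))\<^sup>2)"
      using two_mult_le_weighted_squares[of 1 "norm (f x)" "norm (g x)"]
        mult_nonneg_nonneg[OF norm_ge_zero norm_ge_zero, of "f x" "g x"]
      unfolding norm_mult real_norm_def by linarith
  qed
qed

lemma borel_measurable_cnj:
  "f \<in> borel_measurable M \<Longrightarrow> (\<lambda>x. cnj (f x)) \<in> borel_measurable M"
  by (rule measurable_compose[OF _ borel_measurable_continuous_onI]) (auto intro: continuous_intros)

lemma l2_cnj: "l2 f \<Longrightarrow> l2 (\<lambda>x. cnj (f x))"
  by (auto simp: l2_def intro: borel_measurable_cnj)

lemma l2_mult_cnj_bound:
  assumes "l2 f" "l2 g" "e > 0"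
  shows "norm (LINT x|lborel. f x * cnj (g x)) \<le>
     (e * (LINT x|lborel. (norm (f x))\<^sup>2) + (LINT x|lborel. (norm (g x))\<^sup>2) / e) / 2"
proof -
  have "norm (LINT x|lborel. f x * cnj (g x)) \<le> (LINT x|lborel. norm (f x * cnj (g x)))"
    by (rule integral_norm_bound)
  also have "\<dots> \<le> (LINT x|lborel. (e * (norm (f x))\<^sup>2 + (norm (g x))\<^sup>2 / e) / 2)"
  proof (rule integral_mono)
    show "integrable lborel (\<lambda>x. norm (f x * cnj (g x)))"
      using l2_mult_integrable[OF assms(1) l2_cnj[OF assms(2)]] by simp
    show "integrable lborel (\<lambda>x. (e * (norm (f x))\<^sup>2 + (norm (g x))\<^sup>2 / e) / 2)"
      using assms by (auto simp: l2_def)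
    show "norm (f x * cnj (g x)) \<le> (e * (norm (f x))\<^sup>2 + (norm (g x))\<^sup>2 / e) / 2" for x
      using two_mult_le_weighted_squares[OF assms(3), of "norm (f x)" "norm (g x)"]
      by (simp add: norm_mult)
  qed
  also have "\<dots> = (e * (LINT x|lborel. (norm (f x))\<^sup>2) + (LINT x|lborel. (norm (g x))\<^sup>2) / e) / 2"
    using assms by (simp add: l2_def)
  finally show ?thesis .
qed

lemma l2_diff_scale:
  assumes "l2 f" "l2 g"
  shows "l2 (\<lambda>x. f x - c * g x)"
  unfolding l2_def
proof
  show [measurable]: "(\<lambda>x. f x - c * g x) \<in> borel_measurable borel"
    using assms by (auto simp: l2_def)
  show "integrable lborel (\<lambda>x. (norm (f x - c * g x))\<^sup>2)"
  proof (rule Bochner_Integration.integrable_bound)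
    show "integrable lborel (\<lambda>x. 2 * (norm (f x))\<^sup>2 + 2 * (norm c)\<^sup>2 * (norm (g x))\<^sup>2)"
      using assms by (auto simp: l2_def)
    show "AE x in lborel. norm ((norm (f x - c * g x))\<^sup>2)
        \<le> norm (2 * (norm (f x))\<^sup>2 + 2 * (norm c)\<^sup>2 * (norm (g x))\<^sup>2)"
    proof (rule AE_I2)
      fix x
      have "(norm (f x - c * g x))\<^sup>2 \<le> (norm (f x) + norm c * norm (g x))\<^sup>2"
        by (metis norm_ge_zero norm_mult norm_triangle_ineq4 power_mono)
      also have "\<dots> \<le> 2 * (norm (f x))\<^sup>2 + 2 * (norm c * norm (g x))\<^sup>2"
        using sum_squares_bound[of "norm (f x)" "norm c * norm (g x)"]
        by (simp add: power2_sum)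
      finally show "norm ((norm (f x - c * g x))\<^sup>2)
        \<le> norm (2 * (norm (f x))\<^sup>2 + 2 * (norm c)\<^sup>2 * (norm (g x))\<^sup>2)"
        by (simp add: power_mult_distrib)
    qed
  qed measurable
qed

lemma l2_scale: "l2 f \<Longrightarrow> l2 (\<lambda>x. c * f x)"
  by (auto simp: l2_def norm_mult power_mult_distrib)

section \<open>Integration by parts on the whole line\<close>

lemma integral_derivative_eq_0:
  fixes F f :: "real \<Rightarrow> complex"
  assumes "\<And>x. (F has_vector_derivative f x) (at x)" "continuous_on UNIV f"
    and "integrable lborel f" "(F \<longlongrightarrow> 0) at_top" "(F \<longlongrightarrow> 0) at_bot"
  shows "(LINT x|lborel. f x) = 0"
proof -
  have "(LBINT x=-\<infinity>..\<infinity>. f x) = 0 - 0"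
  proof (rule interval_integral_FTC_integrable)
    show "((F \<circ> real_of_ereal) \<longlongrightarrow> 0) (at_right (- \<infinity>))" "((F \<circ> real_of_ereal) \<longlongrightarrow> 0) (at_left \<infinity>)"
      using assms by (auto simp: ereal_tendsto_simps)
    show "set_integrable lborel (einterval (- \<infinity>) \<infinity>) f"
      using assms(3) by (simp add: set_integrable_def)
    show "isCont f x" for x
      using assms(2) continuous_on_eq_continuous_at by blast
  qed (use assms in auto)
  then show ?thesis
    by (simp add: interval_lebesgue_integral_def set_lebesgue_integral_def)
qed

lemma integral_by_parts_line:
  fixes f g f' g' :: "real \<Rightarrow> complex"
  assumes "\<And>x. (f has_vector_derivative f' x) (at x)" "\<And>x. (g has_vector_derivative g' x) (at x)"
    and "continuous_on UNIV f'" "continuous_on UNIV g'"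
    and "integrable lborel (\<lambda>x. f' x * g x)" "integrable lborel (\<lambda>x. f x * g' x)"
    and "((\<lambda>x. f x * g x) \<longlongrightarrow> 0) at_top" "((\<lambda>x. f x * g x) \<longlongrightarrow> 0) at_bot"
  shows "(LINT x|lborel. f' x * g x) = - (LINT x|lborel. f x * g' x)"
proof -
  have cont: "continuous_on UNIV f" "continuous_on UNIV g"
    using assms(1,2) by (meson continuous_at_imp_continuous_on has_vector_derivative_continuous)+
  have "(LINT x|lborel. f x * g' x + f' x * g x) = 0"
    by (rule integral_derivative_eq_0[where F = "\<lambda>x. f x * g x"])
       (use assms cont in \<open>auto intro!: continuous_intros has_vector_derivative_mult\<close>)
  then show ?thesis
    using assms(5,6) by (simp add: eq_neg_iff_add_eq_0 add.commute)
qed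

subsection \<open>Band-limited kernels\<close>

lemma integrable_inverse_1_plus_square: "integrable lborel (\<lambda>x::real. 1 / (1 + x\<^sup>2))"
proof -
  have "set_integrable lborel (einterval (-\<infinity>) \<infinity>) (\<lambda>x. inverse (1 + x\<^sup>2))"
  proof (rule interval_integral_FTC_nonneg)
    show "((arctan \<circ> real_of_ereal) \<longlongrightarrow> - (pi / 2)) (at_right (- \<infinity>))"
      "((arctan \<circ> real_of_ereal) \<longlongrightarrow> pi / 2) (at_left \<infinity>)"
      by (simp_all add: ereal_tendsto_simps tendsto_arctan_at_bot tendsto_arctan_at_top)
    show "isCont (\<lambda>x. inverse (1 + x\<^sup>2)) x" for x :: real
      by (intro continuous_intros) (auto simp: add_nonneg_eq_0_iff)
  qed (auto intro: DERIV_arctan)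
  then show ?thesis
    by (simp add: set_integrable_def inverse_eq_divide)
qed

text \<open>The \<open>k\<close>-th derivative in \<open>y\<close> of the integral of
  \<open>(1 - s) * exp (\<i> * y * s)\<close> over \<open>s\<close> from 0 to 1. For
  \<open>k = 0\<close> and \<open>y \<noteq> 0\<close> its real part is
  \<open>(1 - cos y) / y\<^sup>2\<close>, a Fejer kernel: half the Fourier transform of the triangle
  function on [-1, 1]. Since the frequencies \<open>s\<close> stay below 1, so do all
  derivatives.\<close>

definition fejer_fourier :: "nat \<Rightarrow> real \<Rightarrow> complex" where
  "fejer_fourier k y = integral {0..1} (\<lambda>s. of_real (1 - s) * (\<i> * of_real s) ^ k * exp (\<i> * of_real (y * s)))"

lemma fejer_fourier_integrable:
  "(\<lambda>s. of_real (1 - s) * (\<i> * of_real s) ^ k * exp (\<i> * of_real (y * s))) integrable_on {0..1::real}"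
  by (intro integrable_continuous_interval continuous_intros)

lemma fejer_fourier_has_vector_derivative:
  "(fejer_fourier k has_vector_derivative fejer_fourier (Suc k) y) (at y)"
proof -
  define g where "g = (\<lambda>k y s. of_real (1 - s) * (\<i> * of_real s) ^ k * exp (\<i> * of_real (y * s)) :: complex)"
  have "((\<lambda>y. integral (cbox 0 1) (g k y)) has_vector_derivative integral (cbox 0 1) (g (Suc k) y))
      (at y within UNIV)"
  proof (rule leibniz_rule_vector_derivative)
    fix x t :: real
    show "((\<lambda>x. g k x t) has_vector_derivative g (Suc k) x t) (at x within UNIV)"
      unfolding g_def of_real_mult
      by (auto intro!: derivative_eq_intros has_vector_derivative_real_field simp: algebra_simps)
    show "g k x integrable_on cbox 0 1"
      unfolding g_def using fejer_fourier_integrable by simp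
    show "continuous_on (UNIV \<times> cbox 0 1) (\<lambda>(x, t). g (Suc k) x t)"
      unfolding g_def case_prod_unfold by (intro continuous_intros)
  qed auto
  moreover have "fejer_fourier k = (\<lambda>y. integral (cbox 0 1) (g k y))" for k
    by (simp add: fun_eq_iff fejer_fourier_def g_def)
  ultimately show ?thesis by simp
qed

lemma fejer_fourier_bound: "norm (fejer_fourier k y) \<le> 1"
proof -
  have "norm (fejer_fourier k y) \<le> integral {0..1} (\<lambda>s::real. 1::real)"
    unfolding fejer_fourier_def
  proof (rule integral_norm_bound_integral)
    show "norm (of_real (1 - s) * (\<i> * of_real s) ^ k * exp (\<i> * of_real (y * s))) \<le> 1"
      if "s \<in> {0..1}" for s
    proof -
      have "norm (of_real (1 - s) :: complex) = 1 - s"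
        using that by (simp only: norm_of_real) simp
      then show ?thesis
        using that by (auto simp: norm_mult norm_power power_le_one intro!: mult_le_one)
    qed
  qed (use fejer_fourier_integrable in auto)
  then show ?thesis by simp
qed

text \<open>Integrating by parts twice; the boundary term of order \<open>y\<close> survives for \<open>k = 0\<close> only, and is
  then imaginary.\<close>

lemma fejer_fourier_0: "- (of_real y)\<^sup>2 * fejer_fourier 0 y = exp (\<i> * of_real y) - \<i> * of_real y - 1"
proof -
  define F :: "complex \<Rightarrow> complex" where "F = (\<lambda>s. (\<i> * of_real y * (1 - s) + 1) * exp (\<i> * of_real y * s))"
  have "((\<lambda>s. - (of_real y)\<^sup>2 * (of_real (1 - s) * (\<i> * of_real s) ^ 0 * exp (\<i> * of_real (y * s))))
      has_integral F (of_real 1) - F (of_real 0)) {0..1}"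
  proof (rule fundamental_theorem_of_calculus)
    fix s :: real
    have "((\<lambda>s. F (of_real s)) has_vector_derivative
        - (of_real y)\<^sup>2 * (of_real (1 - s) * exp (\<i> * of_real (y * s)))) (at s)"
      unfolding F_def
      by (rule has_vector_derivative_real_field)
         (auto intro!: derivative_eq_intros simp: algebra_simps power2_eq_square)
    then show "((\<lambda>s. F (of_real s)) has_vector_derivative
        - (of_real y)\<^sup>2 * (of_real (1 - s) * (\<i> * of_real s) ^ 0 * exp (\<i> * of_real (y * s)))) (at s within {0..1})"
      by (auto intro: has_vector_derivative_at_within)
  qed simp
  from integral_unique[OF this] show ?thesis
    unfolding fejer_fourier_def integral_mult_right by (simp add: F_def)
qed

lemma fejer_fourier_Suc:
  "y\<^sup>2 * norm (fejer_fourier (Suc k) y) \<le> 2 * 4 ^ Suc k"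
proof -
  \<comment> \<open>The powers of \<open>\<i>\<close> are split off, leaving the polynomial
    \<open>(1 - s) * s ^ Suc k\<close> with derivatives \<open>p1\<close> and \<open>p2\<close>. Two
    integrations by parts are condensed into the antiderivative \<open>F\<close>; as
    \<open>p\<close> vanishes at 0 and 1, no boundary term of order \<open>y\<close>
    survives.\<close>
  define p :: "complex \<Rightarrow> complex" where "p = (\<lambda>s. s ^ Suc k - s ^ Suc (Suc k))"
  define p1 :: "complex \<Rightarrow> complex" where "p1 = (\<lambda>s. of_nat (Suc k) * s ^ k - of_nat (Suc (Suc k)) * s ^ Suc k)"
  define p2 :: "complex \<Rightarrow> complex" where
    "p2 = (\<lambda>s. of_nat (Suc k) * of_nat k * s ^ (k - 1) - of_nat (Suc (Suc k)) * of_nat (Suc k) * s ^ k)"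
  define e :: "complex \<Rightarrow> complex" where "e = (\<lambda>s. exp (\<i> * of_real y * s))"
  define F :: "complex \<Rightarrow> complex" where "F = (\<lambda>s. (\<i> * of_real y * p s - p1 s) * e s)"
  have [derivative_intros]: "(p has_field_derivative p1 s) (at s)" for s
    using DERIV_diff[OF DERIV_power[OF DERIV_ident, of "Suc k" s UNIV] DERIV_power[OF DERIV_ident, of "Suc (Suc k)" s UNIV]]
    by (simp only: p_def p1_def diff_Suc_Suc diff_zero mult_1)
  have [derivative_intros]: "(p1 has_field_derivative p2 s) (at s)" for s
    using DERIV_diff[OF DERIV_cmult[OF DERIV_power[OF DERIV_ident, of k s UNIV], of "of_nat (Suc k)"]
        DERIV_cmult[OF DERIV_power[OF DERIV_ident, of "Suc k" s UNIV], of "of_nat (Suc (Suc k))"]]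
    by (simp only: p1_def p2_def diff_Suc_Suc diff_zero mult_1 mult.assoc One_nat_def)
  have [derivative_intros]: "(e has_field_derivative \<i> * of_real y * e s) (at s)" for s
    unfolding e_def by (auto intro!: derivative_eq_intros)
  have "((\<lambda>s. - (of_real y)\<^sup>2 * (p (of_real s) * e (of_real s)) - p2 (of_real s) * e (of_real s))
      has_integral F (of_real 1) - F (of_real 0)) {0..1}"
  proof (rule fundamental_theorem_of_calculus)
    fix s :: real
    have "((\<lambda>s. F (of_real s)) has_vector_derivative
        - (of_real y)\<^sup>2 * (p (of_real s) * e (of_real s)) - p2 (of_real s) * e (of_real s)) (at s)"
      unfolding F_def
      by (rule has_vector_derivative_real_field)
         (auto intro!: derivative_eq_intros simp: algebra_simps power2_eq_square)
    then show "((\<lambda>s. F (of_real s)) has_vector_derivative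
        - (of_real y)\<^sup>2 * (p (of_real s) * e (of_real s)) - p2 (of_real s) * e (of_real s)) (at s within {0..1})"
      by (rule has_vector_derivative_at_within)
  qed simp
  then have 1: "integral {0..1} (\<lambda>s. - (of_real y)\<^sup>2 * (p (of_real s) * e (of_real s)) - p2 (of_real s) * e (of_real s))
      = F 1 - F 0"
    by (simp add: integral_unique)
  have int: "(\<lambda>s. p (of_real s) * e (of_real s)) integrable_on {0..1}"
    "(\<lambda>s. p2 (of_real s) * e (of_real s)) integrable_on {0..1::real}"
    unfolding p_def p2_def e_def by (intro integrable_continuous_interval continuous_intros)+
  have 2: "fejer_fourier (Suc k) y = \<i> ^ Suc k * integral {0..1} (\<lambda>s. p (of_real s) * e (of_real s))"
    unfolding fejer_fourier_def p_def e_def integral_mult_right[symmetric]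
    by (intro integral_cong) (simp add: power_mult_distrib algebra_simps)
  have "- (of_real y)\<^sup>2 * integral {0..1} (\<lambda>s. p (of_real s) * e (of_real s)) -
     integral {0..1} (\<lambda>s. p2 (of_real s) * e (of_real s)) = F 1 - F 0"
    using 1 unfolding Henstock_Kurzweil_Integration.integral_diff[OF
        integrable_on_mult_right[OF int(1), of "- (of_real y)\<^sup>2"] int(2)] integral_mult_right .
  then have "- (of_real y)\<^sup>2 * integral {0..1} (\<lambda>s. p (of_real s) * e (of_real s)) =
     F 1 - F 0 + integral {0..1} (\<lambda>s. p2 (of_real s) * e (of_real s))"
    by (metis diff_add_cancel)
  then have "norm (- (of_real y)\<^sup>2 * integral {0..1} (\<lambda>s. p (of_real s) * e (of_real s))) \<le>
     norm (F 1) + norm (F 0) + norm (integral {0..1} (\<lambda>s. p2 (of_real s) * e (of_real s)))"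
    using norm_triangle_ineq[of "F 1 - F 0"] norm_triangle_ineq4[of "F 1" "F 0"]
    by (smt (verit))
  moreover have "norm (- (of_real y)\<^sup>2 * integral {0..1} (\<lambda>s. p (of_real s) * e (of_real s)))
     = y\<^sup>2 * norm (fejer_fourier (Suc k) y)"
    unfolding 2 norm_mult norm_power norm_minus_cancel norm_ii norm_of_real power_one abs_power2 by simp
  moreover have "norm (F 1) \<le> 1" "norm (F 0) \<le> 1"
  proof -
    have "p 1 = 0" "p1 1 = -1" "p 0 = 0" by (simp_all add: p_def p1_def)
    moreover have "norm (p1 0) \<le> 1" by (cases k) (simp_all add: p1_def)
    moreover have "norm (e 0) = 1" "norm (e 1) = 1" by (simp_all add: e_def)
    ultimately show "norm (F 1) \<le> 1" "norm (F 0) \<le> 1" by (simp_all add: F_def norm_mult)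
  qed
  moreover have "norm (integral {0..1} (\<lambda>s. p2 (of_real s) * e (of_real s)))
     \<le> integral {0..1} (\<lambda>s::real. real (Suc k) * real k + real (Suc (Suc k)) * real (Suc k))"
  proof (rule integral_norm_bound_integral)
    fix s :: real assume s: "s \<in> {0..1}"
    have "norm (p2 (of_real s) * e (of_real s)) = norm (p2 (of_real s))"
      by (simp add: e_def norm_mult)
    also have "\<dots> \<le> real (Suc k) * real k * s ^ (k - 1) + real (Suc (Suc k)) * real (Suc k) * s ^ k"
      unfolding p2_def using s
      by (intro order_trans[OF norm_triangle_ineq4]) (simp add: norm_mult norm_power del: of_nat_Suc)
    also have "\<dots> \<le> real (Suc k) * real k * 1 + real (Suc (Suc k)) * real (Suc k) * 1"
      using s by (intro add_mono mult_left_mono power_le_one) auto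
    finally show "norm (p2 (of_real s) * e (of_real s)) \<le> real (Suc k) * real k + real (Suc (Suc k)) * real (Suc k)"
      by simp
  qed (use int in auto)
  ultimately have "y\<^sup>2 * norm (fejer_fourier (Suc k) y) \<le> 
      1 + 1 + (real (Suc k) * real k + real (Suc (Suc k)) * real (Suc k))"
    by simp
  also have "\<dots> \<le> 2 * real (Suc (Suc k)) ^ 2"
    by (simp add: power2_eq_square algebra_simps)
  \<comment> \<open>The quadratic growth in \<open>k\<close> is coarsened to a geometric one, the
    form \<open>B * A ^ k\<close> of the bound in \<open>decaying_kernel\<close>.\<close>
  also have "real (Suc (Suc k)) \<le> 2 ^ Suc k"
    by (induction k) auto
  then have "2 * real (Suc (Suc k)) ^ 2 \<le> 2 * (2 ^ Suc k)\<^sup>2"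
    by (intro mult_left_mono power_mono) auto
  also have "\<dots> = 2 * 4 ^ Suc k"
    unfolding power_even_eq[symmetric] power_mult by simp
  finally show ?thesis .
qed

text \<open>\<open>\<kappa> k\<close> is the \<open>k\<close>-th derivative of
  \<open>\<kappa> 0\<close>. Geometric growth in \<open>k\<close> is what every admissible weight
  tolerates: the sum of \<open>v k * A ^ (2 * k)\<close> is a value of the everywhere convergent
  power series of \<open>v\<close>. The factor \<open>1 / (1 + y\<^sup>2)\<close> makes all the
  derivatives integrable.\<close>

locale decaying_kernel =
  fixes \<kappa> :: "nat \<Rightarrow> real \<Rightarrow> real" and A B :: real
  assumes deriv: "\<And>k y. (\<kappa> k has_real_derivative \<kappa> (Suc k) y) (at y)"
    and bound: "\<And>k y. \<bar>\<kappa> k y\<bar> \<le> B * A ^ k * (1 / (1 + y\<^sup>2))"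
    and A_pos: "A > 0"
begin

lemma B_nonneg: "B \<ge> 0"
  using bound[of 0 0] by auto

lemma continuous: "continuous_on S (\<kappa> k)"
  by (meson DERIV_continuous deriv continuous_at_imp_continuous_on)

lemma bounded: "\<bar>\<kappa> k y\<bar> \<le> B * A ^ k"
proof -
  have "B * A ^ k * (1 / (1 + y\<^sup>2)) \<le> B * A ^ k * 1"
    using B_nonneg A_pos by (intro mult_left_mono) (auto simp: divide_le_eq_1 add_pos_nonneg)
  then show ?thesis using bound[of k y] by simp
qed

lemma measurable [measurable]: "\<kappa> k \<in> borel_measurable borel"
  by (rule borel_measurable_continuous_onI[OF continuous])

lemma integrable: "integrable lborel (\<kappa> k)"
  by (rule Bochner_Integration.integrable_bound[OF
        integrable_mult_right[OF integrable_inverse_1_plus_square, of "B * A ^ k"]])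
     (use order_trans[OF bound abs_ge_self] in auto)

text \<open>The dilates \<open>t * \<kappa> 0 (t * y)\<close> keep the integral of
  \<open>\<kappa> 0\<close> and concentrate at 0 as \<open>t\<close> grows. The constants become
  worse with \<open>t\<close>; convergence of the power series of \<open>v\<close> at every point
  absorbs this.\<close>

lemma scaled:
  assumes "t \<ge> 1"
  shows "decaying_kernel (\<lambda>k y. t ^ Suc k * \<kappa> k (t * y)) (t * A) (t * B)"
proof
  fix k y
  show "((\<lambda>y. t ^ Suc k * \<kappa> k (t * y)) has_real_derivative t ^ Suc (Suc k) * \<kappa> (Suc k) (t * y)) (at y)"
    by (auto intro!: derivative_eq_intros DERIV_chain2[OF deriv])
  have "\<bar>t ^ Suc k * \<kappa> k (t * y)\<bar> \<le> t ^ Suc k * (B * A ^ k * (1 / (1 + (t * y)\<^sup>2)))"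
    using assms unfolding abs_mult by (intro mult_mono bound) auto
  also have "\<dots> \<le> t ^ Suc k * (B * A ^ k * (1 / (1 + y\<^sup>2)))"
  proof (intro mult_left_mono divide_left_mono)
    have "1 * y\<^sup>2 \<le> t\<^sup>2 * y\<^sup>2"
      using assms by (intro mult_right_mono) auto
    then show "1 + y\<^sup>2 \<le> 1 + (t * y)\<^sup>2" by (simp add: power_mult_distrib)
  qed (use assms B_nonneg A_pos in \<open>auto intro!: add_pos_nonneg mult_pos_pos\<close>)
  also have "\<dots> = t * B * (t * A) ^ k * (1 / (1 + y\<^sup>2))"
    by (simp add: power_mult_distrib)
  finally show "\<bar>t ^ Suc k * \<kappa> k (t * y)\<bar> \<le> t * B * (t * A) ^ k * (1 / (1 + y\<^sup>2))" .
  show "t * A > 0" using assms A_pos by simp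
qed

end

text \<open>The constant 3 adds the bound 1 on the function and the bound 2 on
  \<open>y\<^sup>2\<close> times the function, both relative to \<open>4 ^ k\<close>. For
  \<open>k = 0\<close> only the real part decays quadratically, so it is taken before
  estimating.\<close>

lemma decaying_kernel_fejer: "decaying_kernel (\<lambda>k y. Re (fejer_fourier k y)) 4 3"
proof
  fix k y
  show "((\<lambda>y. Re (fejer_fourier k y)) has_real_derivative Re (fejer_fourier (Suc k) y)) (at y)"
    using bounded_linear.has_vector_derivative[OF bounded_linear_Re fejer_fourier_has_vector_derivative]
    by (simp add: has_real_derivative_iff_has_vector_derivative)
  have 1: "\<bar>Re (fejer_fourier k y)\<bar> \<le> 1 * 4 ^ k"
    using order_trans[OF abs_Re_le_cmod fejer_fourier_bound, of k y] one_le_power[of "4::real" k] by linarith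
  have 2: "y\<^sup>2 * \<bar>Re (fejer_fourier k y)\<bar> \<le> 2 * 4 ^ k"
  proof (cases k)
    case 0
    have "Re (- (of_real y)\<^sup>2 * fejer_fourier 0 y) = cos y - 1"
      unfolding fejer_fourier_0 by (simp add: Re_exp)
    then have "y\<^sup>2 * Re (fejer_fourier 0 y) = 1 - cos y"
      by (simp flip: of_real_power)
    then have "y\<^sup>2 * \<bar>Re (fejer_fourier 0 y)\<bar> = \<bar>1 - cos y\<bar>"
      by (metis abs_mult abs_power2)
    then show ?thesis using 0 cos_ge_minus_one[of y] cos_le_one[of y] by simp
  next
    case (Suc j)
    have "y\<^sup>2 * \<bar>Re (fejer_fourier k y)\<bar> \<le> y\<^sup>2 * norm (fejer_fourier k y)"
      by (intro mult_left_mono abs_Re_le_cmod) auto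
    then show ?thesis using fejer_fourier_Suc[of y j] Suc by simp
  qed
  have "0 < 1 + y\<^sup>2" by (simp add: add_pos_nonneg)
  then show "\<bar>Re (fejer_fourier k y)\<bar> \<le> 3 * 4 ^ k * (1 / (1 + y\<^sup>2))"
    using 1 2 by (simp add: pos_le_divide_eq algebra_simps)
qed simp

text \<open>Off the null set \<open>{0}\<close> the kernel is
  \<open>(1 - cos y) / y\<^sup>2\<close>, hence nonnegative. Were its integral 0, it would vanish
  almost everywhere and by continuity everywhere, yet its value at \<open>pi\<close> is
  \<open>2 / pi\<^sup>2\<close>. The integral is divided out at the end of the main proof.\<close>

lemma integral_fejer_pos: "(LINT y|lborel. Re (fejer_fourier 0 y)) > 0"
proof -
  interpret decaying_kernel "\<lambda>k y. Re (fejer_fourier k y)" 4 3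
    by (rule decaying_kernel_fejer)
  have *: "y\<^sup>2 * Re (fejer_fourier 0 y) = 1 - cos y" for y
  proof -
    have "Re (- (of_real y)\<^sup>2 * fejer_fourier 0 y) = cos y - 1"
      unfolding fejer_fourier_0 by (simp add: Re_exp)
    then show ?thesis by (simp flip: of_real_power)
  qed
  have pos: "Re (fejer_fourier 0 y) \<ge> 0" if "y \<noteq> 0" for y
  proof -
    have "y\<^sup>2 * Re (fejer_fourier 0 y) \<ge> 0" using * by simp
    then show ?thesis using that by (simp add: zero_le_mult_iff)
  qed
  have AE: "AE y in lborel. Re (fejer_fourier 0 y) \<ge> 0"
    using AE_lborel_singleton[of "0::real"] by eventually_elim (use pos in auto)
  have "(LINT y|lborel. Re (fejer_fourier 0 y)) \<noteq> 0"
  proof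
    assume "(LINT y|lborel. Re (fejer_fourier 0 y)) = 0"
    then have "AE y in lborel. Re (fejer_fourier 0 y) = 0"
      using integral_nonneg_eq_0_iff_AE[OF integrable[of 0] AE] by simp
    then have "AE y in lebesgue. Re (fejer_fourier 0 y) = 0"
      by (rule AE_completion)
    then have "AE y in lebesgue. y \<in> UNIV \<longrightarrow> y \<in> {y. Re (fejer_fourier 0 y) = 0}"
      by simp
    moreover have "closed {y. Re (fejer_fourier 0 y) = 0}"
      using continuous[of UNIV 0] by (intro closed_Collect_eq) auto
    ultimately have "Re (fejer_fourier 0 pi) = 0"
      using mem_closed_if_AE_lebesgue[of "{y. Re (fejer_fourier 0 y) = 0}" pi] by simp
    then show False using *[of pi] by simp
  qed
  moreover have "(LINT y|lborel. Re (fejer_fourier 0 y)) \<ge> 0"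
    using AE by (rule integral_nonneg_AE)
  ultimately show ?thesis by simp
qed

subsection \<open>Convolution\<close>

definition conv :: "(real \<Rightarrow> complex) \<Rightarrow> (real \<Rightarrow> real) \<Rightarrow> real \<Rightarrow> complex" where
  "conv f k x = (LINT y|lborel. f y * of_real (k (x - y)))"

lemma integrable_reflect_iff:
  fixes f :: "real \<Rightarrow> 'a :: {banach, second_countable_topology}"
  shows "integrable lborel (\<lambda>y. f (x - y)) \<longleftrightarrow> integrable lborel f"
  using lborel_integrable_real_affine_iff[of "-1" f x] by simp

lemma integral_reflect:
  fixes f :: "real \<Rightarrow> 'a :: {banach, second_countable_topology}"
  shows "(LINT y|lborel. f (x - y)) = (LINT y|lborel. f y)"
  using lborel_integral_real_affine[of "-1" f x] by simp

lemma conv_swap: "conv f k x = (LINT y|lborel. f (x - y) * of_real (k y))"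
  unfolding conv_def using integral_reflect[of "\<lambda>y. f y * of_real (k (x - y))" x] by simp

lemma conv_bounded_integrable:
  fixes f :: "real \<Rightarrow> complex"
  assumes "f \<in> borel_measurable borel" "\<And>y. norm (f y) \<le> M" "integrable lborel k"
  shows "integrable lborel (\<lambda>y. f y * of_real (k (x - y)))"
proof (rule Bochner_Integration.integrable_bound)
  have k: "integrable lborel (\<lambda>y. k (x - y))"
    using assms(3) by (simp add: integrable_reflect_iff)
  then show "integrable lborel (\<lambda>y. M * k (x - y))" by simp
  show "(\<lambda>y. f y * of_real (k (x - y))) \<in> borel_measurable lborel"
    using assms(1) borel_measurable_integrable[OF k] by simp
  show "AE y in lborel. norm (f y * of_real (k (x - y))) \<le> norm (M * k (x - y))"
    by (auto simp: norm_mult abs_mult intro!: mult_right_mono order_trans[OF assms(2)])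
qed

lemma conv_bounded_integrable':
  fixes f :: "real \<Rightarrow> complex"
  assumes "f \<in> borel_measurable borel" "\<And>y. norm (f y) \<le> M" "integrable lborel k"
  shows "integrable lborel (\<lambda>y. f (x - y) * of_real (k y))"
  using integrable_reflect_iff[of "\<lambda>y. f y * of_real (k (x - y))" x]
    conv_bounded_integrable[OF assms, of x] by simp

lemma l2_of_real_bounded_integrable:
  assumes "k \<in> borel_measurable borel" "integrable lborel k" "\<And>y. \<bar>k y\<bar> \<le> M"
  shows "l2 (\<lambda>y. of_real (k (x - y)))"
  unfolding l2_def
proof
  show "(\<lambda>y. complex_of_real (k (x - y))) \<in> borel_measurable borel"
    using assms(1) by measurable
  show "integrable lborel (\<lambda>y. (norm (complex_of_real (k (x - y))))\<^sup>2)"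
  proof (rule Bochner_Integration.integrable_bound)
    show "integrable lborel (\<lambda>y. M * k (x - y))"
      using assms(2) by (simp add: integrable_reflect_iff)
    show "(\<lambda>y. (norm (complex_of_real (k (x - y))))\<^sup>2) \<in> borel_measurable lborel"
      using assms(1) by measurable
    have "\<bar>k y\<bar> * \<bar>k y\<bar> \<le> \<bar>M\<bar> * \<bar>k y\<bar>" for y
      by (intro mult_right_mono order_trans[OF assms(3)]) auto
    then show "AE y in lborel. norm ((norm (complex_of_real (k (x - y))))\<^sup>2) \<le> norm (M * k (x - y))"
      by (auto simp: abs_mult power2_eq_square)
  qed
qed

lemma conv_l2_integrable:
  assumes "l2 f" "k \<in> borel_measurable borel" "integrable lborel k" "\<And>y. \<bar>k y\<bar> \<le> M"
  shows "integrable lborel (\<lambda>y. f y * of_real (k (x - y)))"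
  by (intro l2_mult_integrable assms(1) l2_of_real_bounded_integrable[OF assms(2-4)])

lemma measurable_conv:
  assumes [measurable]: "f \<in> borel_measurable borel" "k \<in> borel_measurable borel"
  shows "conv f k \<in> borel_measurable borel"
  unfolding conv_def[abs_def] by measurable

text \<open>Cauchy-Schwarz for the measure with density \<open>\<bar>k (x - y)\<bar>\<close>, read
  off from the nonnegative integral of \<open>(N * norm (f y) - I1)\<^sup>2\<close> against it. An
  upper bound \<open>N\<close> in place of the exact mass of the kernel can be chosen positive and
  uniform over a family of kernels.\<close>

lemma norm_conv_square_le:
  assumes f: "l2 f" and k [measurable]: "k \<in> borel_measurable borel"
    and int: "integrable lborel k" and M: "\<And>y. \<bar>k y\<bar> \<le> M" and N: "(LINT y|lborel. \<bar>k y\<bar>) \<le> N" "N > 0"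
  shows "integrable lborel (\<lambda>y. (norm (f y))\<^sup>2 * \<bar>k (x - y)\<bar>)" (is ?int)
    and "(norm (conv f k x))\<^sup>2 \<le> N * (LINT y|lborel. (norm (f y))\<^sup>2 * \<bar>k (x - y)\<bar>)" (is ?le)
proof -
  have [measurable]: "f \<in> borel_measurable borel"
    using f by (simp add: l2_def)
  show ?int
  proof (rule Bochner_Integration.integrable_bound)
    show "integrable lborel (\<lambda>y. M * (norm (f y))\<^sup>2)"
      using f by (simp add: l2_def)
    show "AE y in lborel. norm ((norm (f y))\<^sup>2 * \<bar>k (x - y)\<bar>) \<le> norm (M * (norm (f y))\<^sup>2)"
    proof (rule AE_I2)
      fix y
      have "(norm (f y))\<^sup>2 * \<bar>k (x - y)\<bar> \<le> (norm (f y))\<^sup>2 * M"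
        by (intro mult_left_mono M) auto
      then show "norm ((norm (f y))\<^sup>2 * \<bar>k (x - y)\<bar>) \<le> norm (M * (norm (f y))\<^sup>2)"
        by (simp add: mult.commute[of M])
    qed
  qed measurable
  note int2 = this
  have int1: "integrable lborel (\<lambda>y. norm (f y) * \<bar>k (x - y)\<bar>)"
    using integrable_norm[OF conv_l2_integrable[OF f k int M, of x]] by (simp add: norm_mult)
  have int0: "integrable lborel (\<lambda>y. \<bar>k (x - y)\<bar>)"
    using int by (simp add: integrable_reflect_iff)
  define I1 where "I1 = (LINT y|lborel. norm (f y) * \<bar>k (x - y)\<bar>)"
  define I2 where "I2 = (LINT y|lborel. (norm (f y))\<^sup>2 * \<bar>k (x - y)\<bar>)"
  have "0 \<le> (LINT y|lborel. (N * norm (f y) - I1)\<^sup>2 * \<bar>k (x - y)\<bar>)"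
    by (intro integral_nonneg_AE) auto
  also have "\<dots> = (LINT y|lborel. N\<^sup>2 * ((norm (f y))\<^sup>2 * \<bar>k (x - y)\<bar>) - (2 * N * I1) * (norm (f y) * \<bar>k (x - y)\<bar>)
      + I1\<^sup>2 * \<bar>k (x - y)\<bar>)"
    by (intro Bochner_Integration.integral_cong) (auto simp: power2_eq_square algebra_simps)
  also have "\<dots> = N\<^sup>2 * I2 - 2 * N * I1 * I1 + I1\<^sup>2 * (LINT y|lborel. \<bar>k (x - y)\<bar>)"
    unfolding I1_def I2_def using int0 int1 int2 by simp
  also have "\<dots> \<le> N\<^sup>2 * I2 - 2 * N * I1 * I1 + I1\<^sup>2 * N"
    using N by (intro add_left_mono mult_left_mono) (auto simp: integral_reflect[of "\<lambda>y. \<bar>k y\<bar>"])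
  also have "\<dots> = N * (N * I2 - I1\<^sup>2)"
    by (simp add: power2_eq_square algebra_simps)
  finally have "I1\<^sup>2 \<le> N * I2"
    using \<open>N > 0\<close> by (simp add: zero_le_mult_iff)
  moreover have "norm (conv f k x) \<le> I1"
    unfolding conv_def I1_def by (rule order_trans[OF integral_norm_bound]) (simp add: norm_mult)
  then have "(norm (conv f k x))\<^sup>2 \<le> I1\<^sup>2"
    by (intro power_mono) auto
  ultimately show ?le
    unfolding I2_def by simp
qed

text \<open>Young's inequality for an L2 function and an L1 kernel: the pointwise bound of
  \<open>norm_conv_square_le\<close> is integrated over \<open>x\<close>, and Fubini lets the kernel
  be integrated first.\<close>

lemma conv_l2:
  assumes f: "l2 f" and k [measurable]: "k \<in> borel_measurable borel"
    and int: "integrable lborel k" and M: "\<And>y. \<bar>k y\<bar> \<le> M" and N: "(LINT y|lborel. \<bar>k y\<bar>) \<le> N" "N > 0"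
  shows "l2 (conv f k)"
    and "(LINT x|lborel. (norm (conv f k x))\<^sup>2) \<le> N\<^sup>2 * (LINT y|lborel. (norm (f y))\<^sup>2)"
proof -
  have fm [measurable]: "f \<in> borel_measurable borel" and f2: "integrable lborel (\<lambda>y. (norm (f y))\<^sup>2)"
    using f by (auto simp: l2_def)
  note [measurable] = measurable_conv[OF fm k]
  have k0: "integrable lborel (\<lambda>x. \<bar>k (x - y)\<bar>)" "(LINT x|lborel. \<bar>k (x - y)\<bar>) = (LINT x|lborel. \<bar>k x\<bar>)" for y
    using lborel_integrable_real_affine[of "\<lambda>x. \<bar>k x\<bar>" 1 "-y"] lborel_integral_real_affine[of 1 "\<lambda>x. \<bar>k x\<bar>" "-y"] int
    by (simp_all add: add.commute)
  have joint: "integrable (lborel \<Otimes>\<^sub>M lborel) (\<lambda>(y, x). (norm (f y))\<^sup>2 * \<bar>k (x - y)\<bar>)"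
    by (rule lborel_pair.Fubini_integrable) (use k0 f2 in \<open>auto simp: abs_mult\<close>)
  note I = lborel_pair.Fubini_integral[OF joint] lborel_pair.integrable_snd[OF joint]
  have bound: "(norm (conv f k x))\<^sup>2 \<le> N * (LINT y|lborel. (norm (f y))\<^sup>2 * \<bar>k (x - y)\<bar>)" for x
    by (rule norm_conv_square_le(2)[OF assms])
  have int': "integrable lborel (\<lambda>x. (norm (conv f k x))\<^sup>2)"
  proof (rule Bochner_Integration.integrable_bound)
    show "integrable lborel (\<lambda>x. N * (LINT y|lborel. (norm (f y))\<^sup>2 * \<bar>k (x - y)\<bar>))"
      using I(2) by simp
    show "AE x in lborel. norm ((norm (conv f k x))\<^sup>2) \<le> norm (N * (LINT y|lborel. (norm (f y))\<^sup>2 * \<bar>k (x - y)\<bar>))"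
      using order_trans[OF bound abs_ge_self] by auto
  qed measurable
  show "l2 (conv f k)"
    unfolding l2_def using int' by simp
  have "(LINT x|lborel. (norm (conv f k x))\<^sup>2) \<le> (LINT x|lborel. N * (LINT y|lborel. (norm (f y))\<^sup>2 * \<bar>k (x - y)\<bar>))"
    using I(2) by (intro integral_mono int' bound) simp
  also have "\<dots> = N * (LINT y|lborel. (LINT x|lborel. (norm (f y))\<^sup>2 * \<bar>k (x - y)\<bar>))"
    using I(1) by simp
  also have "\<dots> = N * ((LINT y|lborel. (norm (f y))\<^sup>2) * (LINT x|lborel. \<bar>k x\<bar>))"
    using k0 by simp
  also have "\<dots> \<le> N * ((LINT y|lborel. (norm (f y))\<^sup>2) * N)"
    using N by (intro mult_left_mono) (auto intro: integral_nonneg_AE)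
  finally show "(LINT x|lborel. (norm (conv f k x))\<^sup>2) \<le> N\<^sup>2 * (LINT y|lborel. (norm (f y))\<^sup>2)"
    by (simp add: power2_eq_square mult_ac)
qed

text \<open>Differentiation under the integral sign, the derivative falling on \<open>f\<close>. The
  normalised remainder \<open>q\<close> tends to 0 pointwise and is at most \<open>2 * M'\<close> by
  the mean value inequality, so dominated convergence applies with majorant
  \<open>2 * M' * \<bar>k y\<bar>\<close>.\<close>

lemma conv_has_vector_derivative:
  assumes f': "\<And>x. (f has_vector_derivative f' x) (at x)" and cont: "continuous_on UNIV f'"
    and M: "\<And>x. norm (f x) \<le> M" and M': "\<And>x. norm (f' x) \<le> M'"
    and k: "integrable lborel k"
  shows "(conv f k has_vector_derivative conv f' k x) (at x)"
proof -
  have kb [measurable]: "k \<in> borel_measurable borel"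
    using borel_measurable_integrable[OF k] by simp
  have fm [measurable]: "f \<in> borel_measurable borel"
    using f' by (intro borel_measurable_continuous)
      (meson continuous_at_imp_continuous_on has_vector_derivative_continuous)
  have fm' [measurable]: "f' \<in> borel_measurable borel"
    using cont by (rule borel_measurable_continuous)
  have int: "integrable lborel (\<lambda>y. f (z - y) * of_real (k y))"
    "integrable lborel (\<lambda>y. f' (z - y) * of_real (k y))" for z
    using conv_bounded_integrable'[OF fm M k] conv_bounded_integrable'[OF fm' M' k] by auto
  have M'0: "M' \<ge> 0" using M'[of 0] norm_ge_zero order_trans by blast
  \<comment> \<open>The remainder of the first-order expansion of \<open>f\<close> at
    \<open>x - y\<close>. At \<open>z = x\<close> the convention \<open>1 / 0 = 0\<close> makes it
    0, so its bound holds there too.\<close>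
  define q where "q z y = (1 / norm (z - x)) *\<^sub>R (f (z - y) - (f (x - y) + (z - x) *\<^sub>R f' (x - y)))" for z y
  have q_meas [measurable]: "q z \<in> borel_measurable borel" for z
    unfolding q_def by measurable
  have q_bound: "norm (q z y) \<le> 2 * M'" for z y
  proof -
    have "norm (f (z - y) - f (x - y) - ((z - y) - (x - y)) *\<^sub>R f' (x - y)) \<le> norm ((z - y) - (x - y)) * (2 * M')"
    proof (rule vector_differentiable_bound_linearization[where S = UNIV])
      show "norm (f' t - f' (x - y)) \<le> 2 * M'" for t
        using norm_triangle_ineq4[of "f' t" "f' (x - y)"] M'[of t] M'[of "x - y"] by linarith
    qed (use f' in auto)
    then have "norm (f (z - y) - (f (x - y) + (z - x) *\<^sub>R f' (x - y))) \<le> \<bar>z - x\<bar> * (2 * M')"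
      by (simp add: diff_diff_eq)
    then show ?thesis
      unfolding q_def norm_scaleR using M'0
      by (cases "z = x") (simp_all add: pos_divide_le_eq mult.commute)
  qed
  have q_lim: "((\<lambda>z. q z y) \<longlongrightarrow> 0) (at x)" for y
  proof -
    have "((\<lambda>z. f (z - y)) has_vector_derivative f' (x - y)) (at x)"
      using vector_diff_chain_at[of "\<lambda>z. z - y" 1 x f "f' (x - y)"] f'[of "x - y"]
        has_vector_derivative_diff[OF has_vector_derivative_id has_vector_derivative_const]
      by (simp add: o_def)
    then show ?thesis
      unfolding has_vector_derivative_def has_derivative_within q_def by simp
  qed
  have eq: "(1 / norm (z - x)) *\<^sub>R (conv f k z - (conv f k x + (z - x) *\<^sub>R conv f' k x)) =
    (LINT y|lborel. q z y * of_real (k y))" for z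
  proof -
    have "q z y * of_real (k y) = (1 / norm (z - x)) *\<^sub>R (f (z - y) * of_real (k y) -
       (f (x - y) * of_real (k y) + (z - x) *\<^sub>R (f' (x - y) * of_real (k y))))" for y
      unfolding q_def by (simp add: algebra_simps scaleR_conv_of_real)
    then show ?thesis
      unfolding conv_swap using int by simp
  qed
  have "((\<lambda>z. (LINT y|lborel. q z y * of_real (k y))) \<longlongrightarrow> 0) (at x)"
    unfolding tendsto_at_iff_sequentially
  proof (intro allI impI)
    fix X :: "nat \<Rightarrow> real" assume X: "\<forall>i. X i \<in> UNIV - {x}" "X \<longlonglongrightarrow> x"
    have "(\<lambda>n. (LINT y|lborel. q (X n) y * of_real (k y))) \<longlonglongrightarrow> (LINT y|(lborel :: real measure). (0::complex))"
    proof (rule integral_dominated_convergence[where w = "\<lambda>y. 2 * M' * \<bar>k y\<bar>"])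
      show "AE y in lborel. (\<lambda>n. q (X n) y * of_real (k y)) \<longlonglongrightarrow> 0"
        using q_lim X unfolding tendsto_at_iff_sequentially o_def by (auto intro!: tendsto_mult_left_zero)
      show "AE y in lborel. norm (q (X n) y * of_real (k y)) \<le> 2 * M' * \<bar>k y\<bar>" for n
        using q_bound by (auto simp: norm_mult intro!: mult_right_mono)
    qed (use k in auto)
    then show "((\<lambda>z. (LINT y|lborel. q z y * of_real (k y))) \<circ> X) \<longlonglongrightarrow> 0"
      by (simp add: o_def)
  qed
  then show ?thesis
    unfolding has_vector_derivative_def has_derivative_within eq
    by (simp add: bounded_linear_scaleR_left)
qed

lemma conv_tendsto_at_top:
  assumes [measurable]: "f \<in> borel_measurable borel" and M: "\<And>x. norm (f x) \<le> M"
    and k: "integrable lborel k" and lim: "(f \<longlongrightarrow> 0) at_top"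
  shows "(conv f k \<longlongrightarrow> 0) at_top"
proof -
  have [measurable]: "k \<in> borel_measurable borel"
    using borel_measurable_integrable[OF k] by simp
  have "((\<lambda>x. (LINT y|lborel. f (x - y) * of_real (k y))) \<longlongrightarrow> (LINT y|(lborel :: real measure). (0::complex))) at_top"
  proof (rule integral_dominated_convergence_at_top[where w = "\<lambda>y. M * \<bar>k y\<bar>"
        and s = "\<lambda>x y. f (x - y) * of_real (k y)" and f = "\<lambda>_. 0"])
    have "filterlim (\<lambda>x. x - y) at_top at_top" for y :: real
      using filterlim_tendsto_add_at_top[OF tendsto_const[of "-y"] filterlim_ident] by simp
    then show "AE y in lborel. ((\<lambda>x. f (x - y) * of_real (k y)) \<longlongrightarrow> 0) at_top"
      by (auto intro!: tendsto_mult_left_zero filterlim_compose[OF lim])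
    show "\<forall>\<^sub>F x in at_top. AE y in lborel. norm (f (x - y) * of_real (k y)) \<le> M * \<bar>k y\<bar>"
      using M by (auto simp: norm_mult intro!: mult_right_mono always_eventually)
  qed (use k in auto)
  then show ?thesis
    by (simp add: conv_swap[abs_def])
qed

lemma conv_tendsto_at_bot:
  assumes [measurable]: "f \<in> borel_measurable borel" and M: "\<And>x. norm (f x) \<le> M"
    and k: "integrable lborel k" and lim: "(f \<longlongrightarrow> 0) at_bot"
  shows "(conv f k \<longlongrightarrow> 0) at_bot"
proof -
  have "(conv (\<lambda>x. f (- x)) (\<lambda>y. k (- y)) \<longlongrightarrow> 0) at_top"
  proof (rule conv_tendsto_at_top)
    show "integrable lborel (\<lambda>y. k (- y))"
      using k integrable_reflect_iff[of k 0] by simp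
    show "((\<lambda>x. f (- x)) \<longlongrightarrow> 0) at_top"
      using lim by (simp add: filterlim_at_bot_mirror)
  qed (use M in auto)
  moreover have "conv (\<lambda>x. f (- x)) (\<lambda>y. k (- y)) = (\<lambda>x. conv f k (- x))"
    unfolding conv_def fun_eq_iff
    using integral_reflect[of "\<lambda>y. f y * of_real (k (- _ - y))" 0] by (simp add: add.commute)
  ultimately show ?thesis
    by (simp add: filterlim_at_bot_mirror)
qed

context decaying_kernel begin

lemma conv_integrable:
  fixes f :: "real \<Rightarrow> complex"
  assumes "f \<in> borel_measurable borel" "\<And>y. norm (f y) \<le> M"
  shows "integrable lborel (\<lambda>y. f y * of_real (\<kappa> k (x - y)))"
  by (rule conv_bounded_integrable[OF assms integrable])

lemma reflected_has_vector_derivative: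
  "((\<lambda>y. complex_of_real (\<kappa> j (x - y))) has_vector_derivative of_real (- \<kappa> (Suc j) (x - y))) (at y)"
proof -
  have "((\<lambda>y. \<kappa> j (x - y)) has_real_derivative \<kappa> (Suc j) (x - y) * (0 - 1)) (at y)"
    by (rule DERIV_chain2[OF deriv]) (auto intro!: derivative_eq_intros)
  from has_vector_derivative_of_real[OF this] show ?thesis by simp
qed

text \<open>The minus sign of the integration by parts cancels the one from differentiating
  \<open>\<kappa> j (x - y)\<close> in \<open>y\<close>. The boundary terms vanish since
  \<open>f\<close> tends to 0 and the kernel is bounded.\<close>

lemma conv_deriv_shift:
  assumes f': "\<And>x. (f has_vector_derivative f' x) (at x)" and cont: "continuous_on UNIV f'"
    and M: "\<And>x. norm (f x) \<le> M" and M': "\<And>x. norm (f' x) \<le> M'"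
    and lim: "(f \<longlongrightarrow> 0) at_top" "(f \<longlongrightarrow> 0) at_bot"
  shows "conv f' (\<kappa> j) x = conv f (\<kappa> (Suc j)) x"
proof -
  have f: "f \<in> borel_measurable borel"
    using f' by (intro borel_measurable_continuous)
      (meson continuous_at_imp_continuous_on has_vector_derivative_continuous)
  have lim0: "((\<lambda>y. f y * of_real (\<kappa> j (x - y))) \<longlongrightarrow> 0) F" if "(f \<longlongrightarrow> 0) F" for F
  proof (rule Lim_null_comparison)
    show "((\<lambda>y. norm (f y) * (B * A ^ j)) \<longlongrightarrow> 0) F"
      using tendsto_mult_left_zero[OF tendsto_norm_zero[OF that]] by simp
    show "\<forall>\<^sub>F y in F. norm (f y * of_real (\<kappa> j (x - y))) \<le> norm (f y) * (B * A ^ j)"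
      by (auto simp: norm_mult intro!: mult_left_mono bounded always_eventually)
  qed
  have "(LINT y|lborel. f' y * of_real (\<kappa> j (x - y))) = - (LINT y|lborel. f y * of_real (- \<kappa> (Suc j) (x - y)))"
  proof (rule integral_by_parts_line[OF f' reflected_has_vector_derivative])
    show "continuous_on UNIV (\<lambda>y. complex_of_real (- \<kappa> (Suc j) (x - y)))"
      by (intro continuous_intros continuous_on_compose2[OF continuous]) auto
    show "integrable lborel (\<lambda>y. f' y * of_real (\<kappa> j (x - y)))"
      by (rule conv_integrable[OF borel_measurable_continuous[OF cont] M'])
    show "integrable lborel (\<lambda>y. f y * of_real (- \<kappa> (Suc j) (x - y)))"
      using conv_integrable[OF f M, of "Suc j" x] by simp
  qed (use cont lim lim0 in auto)
  then show ?thesis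
    by (simp add: conv_def)
qed

end

subsection \<open>Limits in the space of square-integrable functions\<close>

lemma fatou_l2:
  assumes f: "\<And>n. l2 (f n)" and M: "\<And>n. (LINT x|lborel. (norm (f n x))\<^sup>2) \<le> M"
    and lim: "\<And>x. (\<lambda>n. f n x) \<longlonglongrightarrow> g x"
  shows "l2 g" and "(LINT x|lborel. (norm (g x))\<^sup>2) \<le> M"
proof -
  have [measurable]: "f n \<in> borel_measurable borel" for n
    using f by (simp add: l2_def)
  have [measurable]: "g \<in> borel_measurable borel"
    by (rule borel_measurable_LIMSEQ_metric[OF _ lim]) simp
  have M0: "0 \<le> M"
    by (rule order_trans[OF _ M[of 0]]) (intro integral_nonneg_AE, simp)
  have "(\<integral>\<^sup>+x. ennreal ((norm (g x))\<^sup>2) \<partial>lborel) = (\<integral>\<^sup>+x. liminf (\<lambda>n. ennreal ((norm (f n x))\<^sup>2)) \<partial>lborel)"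
  proof (rule nn_integral_cong)
    fix x
    have "(\<lambda>n. ennreal ((norm (f n x))\<^sup>2)) \<longlonglongrightarrow> ennreal ((norm (g x))\<^sup>2)"
      by (intro tendsto_ennrealI tendsto_power tendsto_norm lim)
    then show "ennreal ((norm (g x))\<^sup>2) = liminf (\<lambda>n. ennreal ((norm (f n x))\<^sup>2))"
      by (rule lim_imp_Liminf[OF trivial_limit_sequentially, symmetric])
  qed
  also have "\<dots> \<le> liminf (\<lambda>n. (\<integral>\<^sup>+x. ennreal ((norm (f n x))\<^sup>2) \<partial>lborel))"
    by (rule nn_integral_liminf) measurable
  also have "\<dots> \<le> ennreal M"
  proof (rule order_trans[OF Liminf_le_Limsup Limsup_bounded])
    show "\<forall>\<^sub>F n in sequentially. (\<integral>\<^sup>+x. ennreal ((norm (f n x))\<^sup>2) \<partial>lborel) \<le> ennreal M"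
    proof (rule always_eventually, rule allI)
      fix n
      have "(\<integral>\<^sup>+x. ennreal ((norm (f n x))\<^sup>2) \<partial>lborel) = ennreal (LINT x|lborel. (norm (f n x))\<^sup>2)"
        using f[of n] by (intro nn_integral_eq_integral) (auto simp: l2_def)
      then show "(\<integral>\<^sup>+x. ennreal ((norm (f n x))\<^sup>2) \<partial>lborel) \<le> ennreal M"
        using M[of n] by (simp add: ennreal_leI)
    qed
  qed simp
  finally have le: "(\<integral>\<^sup>+x. ennreal ((norm (g x))\<^sup>2) \<partial>lborel) \<le> ennreal M" .
  have int: "integrable lborel (\<lambda>x. (norm (g x))\<^sup>2)"
    by (rule integrableI_bounded) (use le_less_trans[OF le] in auto)
  then show "l2 g" by (simp add: l2_def)
  have "ennreal (LINT x|lborel. (norm (g x))\<^sup>2) \<le> ennreal M"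
    using le nn_integral_eq_integral[OF int] by simp
  then show "(LINT x|lborel. (norm (g x))\<^sup>2) \<le> M"
    using M0 by simp
qed

text \<open>The product \<open>a b\<close> is at most \<open>d\<close> times the larger square plus \<open>1 / d\<close> times the smaller one;
  the integral of the smaller one vanishes in the limit by dominated convergence.\<close>

lemma l2_bounded_weak_limit:
  assumes f: "\<And>n. l2 (f n)" and M: "\<And>n. (LINT x|lborel. (norm (f n x))\<^sup>2) \<le> M"
    and lim: "\<And>x. (\<lambda>n. f n x) \<longlonglongrightarrow> 0" and g: "l2 g"
  shows "(\<lambda>n. (LINT x|lborel. f n x * g x)) \<longlonglongrightarrow> 0"
proof (rule LIMSEQ_I)
  fix e :: real assume "e > 0"
  have fm [measurable]: "f n \<in> borel_measurable borel" and fi: "integrable lborel (\<lambda>x. (norm (f n x))\<^sup>2)" for n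
    using f by (auto simp: l2_def)
  have gm [measurable]: "g \<in> borel_measurable borel" and gi: "integrable lborel (\<lambda>x. (norm (g x))\<^sup>2)"
    using g by (auto simp: l2_def)
  \<comment> \<open>\<open>d * K = e / 2\<close> bounds the first part of the estimate. The integral
    of the smaller square \<open>m\<close> has to fall below \<open>d * (e / 2)\<close> because it
    gets divided by \<open>d\<close>. The summand 1 keeps \<open>K\<close> positive.\<close>
  define K where "K = \<bar>M\<bar> + (LINT x|lborel. (norm (g x))\<^sup>2) + 1"
  have K: "K > 0"
    unfolding K_def by (intro add_nonneg_pos add_nonneg_nonneg integral_nonneg_AE) auto
  define d where "d = e / (2 * K)"
  have d: "d > 0" using K \<open>e > 0\<close> by (simp add: d_def)
  define m where "m n x = min ((norm (f n x))\<^sup>2) ((norm (g x))\<^sup>2)" for n x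
  have "(\<lambda>n. (LINT x|lborel. m n x)) \<longlonglongrightarrow> (LINT x|(lborel :: real measure). 0)"
  proof (rule integral_dominated_convergence[OF _ _ gi])
    show "AE x in lborel. (\<lambda>n. m n x) \<longlonglongrightarrow> 0"
    proof (rule AE_I2)
      fix x
      have "(\<lambda>n. m n x) \<longlonglongrightarrow> min ((norm (0::complex))\<^sup>2) ((norm (g x))\<^sup>2)"
        unfolding m_def by (intro tendsto_min tendsto_power tendsto_norm lim tendsto_const)
      then show "(\<lambda>n. m n x) \<longlonglongrightarrow> 0" by simp
    qed
  qed (auto simp: m_def)
  then have "\<forall>\<^sub>F n in sequentially. (LINT x|lborel. m n x) < d * (e / 2)"
    using d \<open>e > 0\<close> by (intro order_tendstoD(2)) auto
  then obtain N where N: "\<And>n. n \<ge> N \<Longrightarrow> (LINT x|lborel. m n x) < d * (e / 2)"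
    by (auto simp: eventually_sequentially)
  have "norm (LINT x|lborel. f n x * g x) < e" if "n \<ge> N" for n
  proof -
    have mi: "integrable lborel (m n)"
      unfolding m_def[abs_def] using fi gi by (intro integrable_min) auto
    have "norm (LINT x|lborel. f n x * g x) \<le> (LINT x|lborel. norm (f n x * g x))"
      by (rule integral_norm_bound)
    also have "\<dots> \<le> (LINT x|lborel. d * ((norm (f n x))\<^sup>2 + (norm (g x))\<^sup>2) + m n x / d)"
    proof (rule integral_mono)
      show "integrable lborel (\<lambda>x. norm (f n x * g x))"
        using l2_mult_integrable[OF f g] by simp
      show "integrable lborel (\<lambda>x. d * ((norm (f n x))\<^sup>2 + (norm (g x))\<^sup>2) + m n x / d)"
        using fi gi mi by auto
      fix x
      define a b where "a = norm (f n x)" and "b = norm (g x)"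
      have ab: "a \<ge> 0" "b \<ge> 0" by (auto simp: a_def b_def)
      have "a * b \<le> d * a\<^sup>2 + b\<^sup>2 / d" "a * b \<le> d * b\<^sup>2 + a\<^sup>2 / d"
        using two_mult_le_weighted_squares[OF d, of a b] two_mult_le_weighted_squares[OF d, of b a]
          mult_nonneg_nonneg[OF ab] by (simp_all add: mult.commute)
      moreover have "d * a\<^sup>2 \<ge> 0" "d * b\<^sup>2 \<ge> 0" using d by auto
      ultimately have "a * b \<le> d * (a\<^sup>2 + b\<^sup>2) + min (a\<^sup>2) (b\<^sup>2) / d"
        by (auto simp: min_def distrib_left)
      then show "norm (f n x * g x) \<le> d * ((norm (f n x))\<^sup>2 + (norm (g x))\<^sup>2) + m n x / d"
        by (simp add: norm_mult a_def b_def m_def)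
    qed
    also have "\<dots> = d * ((LINT x|lborel. (norm (f n x))\<^sup>2) + (LINT x|lborel. (norm (g x))\<^sup>2)) + (LINT x|lborel. m n x) / d"
      using fi gi mi by simp
    also have "\<dots> < d * K + d * (e / 2) / d"
      using d N[OF that] M[of n] K by (intro add_le_less_mono mult_left_mono divide_strict_right_mono)
        (auto simp: K_def)
    also have "\<dots> = e"
      using K d by (simp add: d_def)
    finally show ?thesis .
  qed
  then show "\<exists>N. \<forall>n\<ge>N. norm ((LINT x|lborel. f n x * g x) - 0) < e"
    by auto
qed

lemma norm_minus_square_le: "(norm (a - b :: complex))\<^sup>2 \<le> 2 * (norm a)\<^sup>2 + 2 * (norm b)\<^sup>2"
proof -
  have "(norm (a - b))\<^sup>2 \<le> (norm a + norm b)\<^sup>2"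
    by (intro power_mono norm_triangle_ineq4) auto
  also have "\<dots> \<le> 2 * (norm a)\<^sup>2 + 2 * (norm b)\<^sup>2"
    using sum_squares_bound[of "norm a" "norm b"] by (simp add: power2_sum)
  finally show ?thesis .
qed

text \<open>At a fixed \<open>x\<close> the convolution is the pairing with a square-integrable
  function, the reflected and translated \<open>k\<close>, so \<open>l2_bounded_weak_limit\<close>
  applies to the differences of \<open>f n\<close> and \<open>g\<close>. By Fatou \<open>g\<close>
  obeys the bound \<open>M\<close> too, whence \<open>4 * M\<close> for the differences.\<close>

lemma conv_l2_bounded_limit:
  assumes f: "\<And>n. l2 (f n)" and M: "\<And>n. (LINT x|lborel. (norm (f n x))\<^sup>2) \<le> M"
    and lim: "\<And>x. (\<lambda>n. f n x) \<longlonglongrightarrow> g x"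
    and k: "k \<in> borel_measurable borel" "integrable lborel k" "\<And>y. \<bar>k y\<bar> \<le> K"
  shows "(\<lambda>n. conv (f n) k x) \<longlonglongrightarrow> conv g k x"
proof -
  note g = fatou_l2[OF f M lim]
  have d: "l2 (\<lambda>x. f n x - 1 * g x)" for n
    by (intro l2_diff_scale f g)
  have d_bound: "(LINT x|lborel. (norm (f n x - 1 * g x))\<^sup>2) \<le> 4 * M" for n
  proof -
    have int: "integrable lborel (\<lambda>x. (norm (f n x))\<^sup>2)" "integrable lborel (\<lambda>x. (norm (g x))\<^sup>2)"
      "integrable lborel (\<lambda>x. (norm (f n x - 1 * g x))\<^sup>2)"
      using f g d by (auto simp: l2_def)
    have "(LINT x|lborel. (norm (f n x - 1 * g x))\<^sup>2) \<le> (LINT x|lborel. 2 * (norm (f n x))\<^sup>2 + 2 * (norm (g x))\<^sup>2)"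
      using int norm_minus_square_le by (intro integral_mono) auto
    also have "\<dots> = 2 * (LINT x|lborel. (norm (f n x))\<^sup>2) + 2 * (LINT x|lborel. (norm (g x))\<^sup>2)"
      using int by simp
    also have "\<dots> \<le> 4 * M"
      using M[of n] g(2) by simp
    finally show ?thesis .
  qed
  have "(\<lambda>n. (LINT y|lborel. (f n y - 1 * g y) * of_real (k (x - y)))) \<longlonglongrightarrow> 0"
    using LIM_zero[OF lim]
    by (intro l2_bounded_weak_limit[OF d d_bound] l2_of_real_bounded_integrable[OF k]) simp
  moreover have "(LINT y|lborel. (f n y - 1 * g y) * of_real (k (x - y))) = conv (f n) k x - conv g k x" for n
    unfolding conv_def using conv_l2_integrable[OF f k] conv_l2_integrable[OF g(1) k]
    by (simp add: left_diff_distrib)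
  ultimately show ?thesis
    by (simp add: LIM_zero_iff)
qed

context decaying_kernel begin

text \<open>Integrability against \<open>1 / (1 + y\<^sup>2)\<close> takes the place of boundedness,
  so that the result covers functions that are merely continuous and in L2. The increment
  \<open>r\<close> is cut off at \<open>\<bar>y\<bar> = 1\<close>: the near part tends to 0 by
  dominated convergence, the far part is of order \<open>1 / t n\<close> by the quadratic decay of
  the kernel.\<close>

lemma approximate_identity:
  assumes cont: "continuous_on UNIV q"
    and int: "integrable lborel (\<lambda>y. norm (q (x - y)) * (1 / (1 + y\<^sup>2)))"
  shows "(\<lambda>n. conv q (\<lambda>y. real (Suc n) * \<kappa> 0 (real (Suc n) * y)) x) \<longlonglongrightarrow> q x * of_real (LINT y|lborel. \<kappa> 0 y)"
proof -
  define t where "t n = real (Suc n)" for n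
  have t: "t n > 0" "t n \<ge> 1" for n by (auto simp: t_def)
  have t_top: "filterlim t at_top sequentially"
    unfolding t_def by (rule filterlim_compose[OF filterlim_real_sequentially filterlim_Suc])
  have qm [measurable]: "q \<in> borel_measurable borel"
    by (rule borel_measurable_continuous[OF cont])
  define r where "r y = q (x - y) - q x" for y
  have rm [measurable]: "r \<in> borel_measurable borel" unfolding r_def by measurable
  define h where "h y = 1 / (1 + y\<^sup>2)" for y :: real
  have hpos: "h y > 0" for y by (simp add: h_def add_pos_nonneg)
  have hm [measurable]: "h \<in> borel_measurable borel" unfolding h_def by measurable
  have rint: "integrable lborel (\<lambda>y. norm (r y) * h y)"
  proof (rule Bochner_Integration.integrable_bound)
    show "integrable lborel (\<lambda>y. norm (q (x - y)) * h y + norm (q x) * h y)"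
      unfolding h_def
      by (intro Bochner_Integration.integrable_add int integrable_mult_right integrable_inverse_1_plus_square)
    have "norm (r y) * h y \<le> (norm (q (x - y)) + norm (q x)) * h y" for y
      unfolding r_def by (intro mult_right_mono norm_triangle_ineq4 less_imp_le[OF hpos])
    then show "AE y in lborel. norm (norm (r y) * h y) \<le> norm (norm (q (x - y)) * h y + norm (q x) * h y)"
      using less_imp_le[OF hpos] by (auto simp: distrib_right abs_mult)
  qed measurable
  define u where "u y = (indicator {-1..1} y :: real)" for y :: real
  have [measurable]: "u \<in> borel_measurable borel" unfolding u_def by measurable
  define k where "k n y = t n * \<kappa> 0 (t n * y)" for n y
  have k_int: "integrable lborel (k n)" for n
    unfolding k_def[abs_def] using lborel_integrable_real_affine[OF integrable[of 0], of "t n" 0] t[of n] by simp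
  have k_total: "(LINT y|lborel. k n y) = (LINT y|lborel. \<kappa> 0 y)" for n
    unfolding k_def[abs_def] using lborel_integral_real_affine[of "t n" "\<kappa> 0" 0] t[of n] by simp
  have km [measurable]: "k n \<in> borel_measurable borel" for n
    using borel_measurable_integrable[OF k_int] by simp
  \<comment> \<open>For \<open>\<bar>y\<bar> \<ge> 1\<close> the quadratic decay of
    \<open>\<kappa> 0\<close> at \<open>t n * y\<close> yields a factor
    \<open>1 / (t n)\<^sup>2\<close>, of which the prefactor \<open>t n\<close> of the dilate
    consumes one power.\<close>
  have k_tail: "\<bar>k n y\<bar> \<le> 2 * B / t n * h y" if "\<bar>y\<bar> \<ge> 1" for n y
  proof -
    have "(t n)\<^sup>2 * 1 \<le> (t n)\<^sup>2 * y\<^sup>2"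
      using that by (intro mult_left_mono) (auto simp flip: abs_le_square_iff[of 1, simplified])
    then have le: "(t n)\<^sup>2 * (1 + y\<^sup>2) \<le> 2 * (1 + (t n * y)\<^sup>2)"
      by (simp add: algebra_simps power_mult_distrib)
    have *: "t n / (1 + (t n * y)\<^sup>2) \<le> 2 / t n * h y"
    proof -
      have pos: "0 < 1 + (t n * y)\<^sup>2" "0 < t n * (1 + y\<^sup>2)"
        using t[of n] by (auto intro!: add_pos_nonneg mult_pos_pos)
      have "t n * (t n * (1 + y\<^sup>2)) \<le> 2 * (1 + (t n * y)\<^sup>2)"
        using le by (simp add: power2_eq_square mult.assoc)
      then have "t n \<le> 2 * (1 + (t n * y)\<^sup>2) / (t n * (1 + y\<^sup>2))"
        by (rule mult_imp_le_div_pos[OF pos(2)])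
      then have "t n / (1 + (t n * y)\<^sup>2) \<le> 2 / (t n * (1 + y\<^sup>2))"
        using pos(1) by (simp add: pos_divide_le_eq)
      then show ?thesis by (simp add: h_def)
    qed
    have "\<bar>k n y\<bar> = t n * \<bar>\<kappa> 0 (t n * y)\<bar>"
      unfolding k_def using t[of n] by (simp add: abs_mult)
    also have "\<dots> \<le> t n * (B * A ^ 0 * (1 / (1 + (t n * y)\<^sup>2)))"
      using t[of n] by (intro mult_left_mono bound) auto
    also have "\<dots> = B * (t n / (1 + (t n * y)\<^sup>2))" by simp
    also have "\<dots> \<le> B * (2 / t n * h y)"
      by (intro mult_left_mono * B_nonneg)
    finally show ?thesis by (simp add: mult_ac)
  qed
  obtain R where R: "\<And>y. \<bar>y\<bar> \<le> 1 \<Longrightarrow> norm (r y) \<le> R"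
  proof -
    have "compact (r ` {-1..1})"
      unfolding r_def by (intro compact_continuous_image continuous_intros continuous_on_compose2[OF cont]) auto
    then obtain R where "\<And>y. y \<in> {-1..1} \<Longrightarrow> norm (r y) \<le> R"
      by (meson bounded_iff compact_imp_bounded imageI)
    then show ?thesis by (intro that[of R]) (simp add: abs_le_iff)
  qed
  have near_bound: "norm (u y *\<^sub>R r y) \<le> \<bar>R\<bar>" for y
    using R[of y] by (auto simp: u_def indicator_def abs_le_iff)
  have near_int: "integrable lborel (\<lambda>y. (u y *\<^sub>R r y) * of_real (k n y))" for n
  proof (rule Bochner_Integration.integrable_bound)
    show "integrable lborel (\<lambda>y. \<bar>R\<bar> * k n y)" using k_int by simp
    show "AE y in lborel. norm ((u y *\<^sub>R r y) * of_real (k n y)) \<le> norm (\<bar>R\<bar> * k n y)"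
      by (rule AE_I2) (simp only: norm_mult norm_of_real real_norm_def abs_mult abs_idempotent,
          intro mult_right_mono near_bound abs_ge_zero)
  qed measurable
  have far_bound: "norm (((1 - u y) *\<^sub>R r y) * of_real (k n y)) \<le> 2 * B / t n * (norm (r y) * h y)" for n y
  proof (cases "\<bar>y\<bar> \<ge> 1")
    case True
    have "norm (((1 - u y) *\<^sub>R r y) * of_real (k n y)) \<le> norm (r y) * \<bar>k n y\<bar>"
      by (auto simp: u_def norm_mult indicator_def)
    also have "\<dots> \<le> norm (r y) * (2 * B / t n * h y)"
      by (intro mult_left_mono k_tail True) auto
    finally show ?thesis by (simp add: mult_ac)
  next
    case False
    then have "- 1 \<le> y \<and> y \<le> 1" by linarith
    then have "u y = 1" by (simp add: u_def)
    then show ?thesis using B_nonneg t[of n] hpos[of y] by simp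
  qed
  have far_int: "integrable lborel (\<lambda>y. ((1 - u y) *\<^sub>R r y) * of_real (k n y))" for n
    by (rule Bochner_Integration.integrable_bound[OF integrable_mult_right[OF rint, of "2 * B / t n"]])
       (use order_trans[OF far_bound abs_ge_self] in auto)
  have near_lim: "(\<lambda>n. (LINT y|lborel. (u y *\<^sub>R r y) * of_real (k n y))) \<longlonglongrightarrow> 0"
  proof -
    \<comment> \<open>Substituting \<open>z = t n * y\<close> makes the kernel independent of
      \<open>n\<close> and moves the dilation into \<open>r (z / t n)\<close>, which tends to
      \<open>r 0 = 0\<close>.\<close>
    have "(LINT y|lborel. (u y *\<^sub>R r y) * of_real (k n y)) =
        (LINT z|lborel. (u (z / t n) *\<^sub>R r (z / t n)) * of_real (\<kappa> 0 z))" for n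
      using lborel_integral_real_affine[of "t n" "\<lambda>z. (u (z / t n) *\<^sub>R r (z / t n)) * of_real (\<kappa> 0 z)" 0] t[of n]
      by (simp add: k_def scaleR_conv_of_real mult_ac flip: integral_mult_right_zero)
    moreover have "(\<lambda>n. (LINT z|lborel. (u (z / t n) *\<^sub>R r (z / t n)) * of_real (\<kappa> 0 z)))
        \<longlonglongrightarrow> (LINT z|(lborel :: real measure). 0)"
    proof (rule integral_dominated_convergence[where w = "\<lambda>z. \<bar>R\<bar> * \<bar>\<kappa> 0 z\<bar>"])
      show "AE z in lborel. norm ((u (z / t n) *\<^sub>R r (z / t n)) * of_real (\<kappa> 0 z)) \<le> \<bar>R\<bar> * \<bar>\<kappa> 0 z\<bar>" for n
        by (rule AE_I2) (simp only: norm_mult norm_of_real, intro mult_right_mono near_bound abs_ge_zero)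
      show "AE z in lborel. (\<lambda>n. (u (z / t n) *\<^sub>R r (z / t n)) * of_real (\<kappa> 0 z)) \<longlonglongrightarrow> 0"
      proof (rule AE_I2)
        fix z
        have "(\<lambda>n. z / t n) \<longlonglongrightarrow> 0"
          by (rule real_tendsto_divide_at_top[OF tendsto_const t_top])
        moreover have "isCont r 0"
          unfolding r_def by (rule continuous_on_interior[of UNIV])
            (auto intro!: continuous_intros continuous_on_compose2[OF cont])
        ultimately have "(\<lambda>n. r (z / t n)) \<longlonglongrightarrow> r 0"
          by (rule isCont_tendsto_compose[rotated])
        then have "(\<lambda>n. norm (r (z / t n)) * \<bar>\<kappa> 0 z\<bar>) \<longlonglongrightarrow> 0"
          by (intro tendsto_mult_left_zero tendsto_norm_zero) (simp add: r_def)
        then show "(\<lambda>n. (u (z / t n) *\<^sub>R r (z / t n)) * of_real (\<kappa> 0 z)) \<longlonglongrightarrow> 0"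
          by (rule Lim_null_comparison[rotated])
             (auto simp: norm_mult u_def indicator_def intro!: always_eventually)
      qed
    qed (use integrable[of 0] in auto)
    ultimately show ?thesis by simp
  qed
  have far_lim: "(\<lambda>n. (LINT y|lborel. ((1 - u y) *\<^sub>R r y) * of_real (k n y))) \<longlonglongrightarrow> 0"
  proof (rule Lim_null_comparison)
    show "(\<lambda>n. 2 * B / t n * (LINT y|lborel. norm (r y) * h y)) \<longlonglongrightarrow> 0"
      by (intro tendsto_mult_left_zero real_tendsto_divide_at_top[OF tendsto_const t_top])
    have "norm (LINT y|lborel. ((1 - u y) *\<^sub>R r y) * of_real (k n y)) \<le>
        (LINT y|lborel. 2 * B / t n * (norm (r y) * h y))" for n
      by (rule order_trans[OF integral_norm_bound
            integral_mono[OF integrable_norm[OF far_int] integrable_mult_right[OF rint] far_bound]])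
    then show "\<forall>\<^sub>F n in sequentially. norm (LINT y|lborel. ((1 - u y) *\<^sub>R r y) * of_real (k n y)) \<le>
        2 * B / t n * (LINT y|lborel. norm (r y) * h y)"
      by simp
  qed
  have "conv q (k n) x = (LINT y|lborel. (u y *\<^sub>R r y) * of_real (k n y)) +
      (LINT y|lborel. ((1 - u y) *\<^sub>R r y) * of_real (k n y)) + q x * of_real (LINT y|lborel. \<kappa> 0 y)" for n
  proof -
    have "conv q (k n) x = (LINT y|lborel. ((u y *\<^sub>R r y) * of_real (k n y) +
        ((1 - u y) *\<^sub>R r y) * of_real (k n y)) + q x * of_real (k n y))"
      unfolding conv_swap by (intro Bochner_Integration.integral_cong)
        (auto simp: r_def scaleR_conv_of_real algebra_simps)
    also have "\<dots> = (LINT y|lborel. (u y *\<^sub>R r y) * of_real (k n y)) +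
      (LINT y|lborel. ((1 - u y) *\<^sub>R r y) * of_real (k n y)) + (LINT y|lborel. q x * of_real (k n y))"
      using near_int[of n] far_int[of n] k_int[of n]
      by (subst Bochner_Integration.integral_add | simp)+
    finally show ?thesis using k_total[of n] by simp
  qed
  moreover have "(\<lambda>n. (LINT y|lborel. (u y *\<^sub>R r y) * of_real (k n y)) +
      (LINT y|lborel. ((1 - u y) *\<^sub>R r y) * of_real (k n y)) + q x * of_real (LINT y|lborel. \<kappa> 0 y))
      \<longlonglongrightarrow> 0 + 0 + q x * of_real (LINT y|lborel. \<kappa> 0 y)"
    by (intro tendsto_add near_lim far_lim tendsto_const)
  ultimately have "(\<lambda>n. conv q (k n) x) \<longlonglongrightarrow> q x * of_real (LINT y|lborel. \<kappa> 0 y)"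
    by simp
  then show ?thesis
    by (simp add: k_def[abs_def] t_def)
qed

end

subsection \<open>Convolution of the operator with a kernel\<close>

lemma continuous_tendsto_0_bounded:
  fixes f :: "real \<Rightarrow> complex"
  assumes "continuous_on UNIV f" "(f \<longlongrightarrow> 0) at_top" "(f \<longlongrightarrow> 0) at_bot"
  obtains M where "\<And>x. norm (f x) \<le> M"
proof -
  have "\<forall>\<^sub>F x in at_top. norm (f x) < 1" "\<forall>\<^sub>F x in at_bot. norm (f x) < 1"
    using assms(2,3) by (auto intro: order_tendstoD(2)[OF tendsto_norm_zero])
  then obtain a b where ab: "\<And>x. x \<ge> a \<Longrightarrow> norm (f x) < 1" "\<And>x. x \<le> b \<Longrightarrow> norm (f x) < 1"
    by (auto simp: eventually_at_top_linorder eventually_at_bot_linorder)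
  have "compact (f ` {b..a})"
    by (rule compact_continuous_image[OF continuous_on_subset[OF assms(1)]]) auto
  then obtain M where M: "\<And>x. x \<in> {b..a} \<Longrightarrow> norm (f x) \<le> M"
    by (meson bounded_iff compact_imp_bounded imageI)
  have "norm (f x) \<le> max 1 M" for x
    using ab[of x] M[of x] by (cases "x \<ge> a"; cases "x \<le> b") auto
  then show ?thesis by (rule that)
qed

lemma smooth_decay_bounded:
  assumes "smooth f" "cauchy_bc f"
  obtains M where "\<And>x. norm (nth_deriv k f x) \<le> M"
  by (rule continuous_tendsto_0_bounded[of "nth_deriv k f"])
     (use assms smooth_continuous_on[OF assms(1)] in \<open>auto simp: cauchy_bc_def\<close>)

lemma borel_measurable_nth_deriv: "smooth f \<Longrightarrow> nth_deriv k f \<in> borel_measurable borel"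
  by (intro borel_measurable_continuous smooth_continuous_on)

context decaying_kernel begin

lemma l2_conv: "l2 f \<Longrightarrow> l2 (conv f (\<kappa> i))"
  by (rule conv_l2(1)[OF _ measurable integrable bounded, where N = "(LINT y|lborel. \<bar>\<kappa> i y\<bar>) + 1"])
     (auto intro!: add_nonneg_pos integral_nonneg_AE)

text \<open>Derivatives of \<open>f\<close> are exchanged for derivatives of the kernel, which are
  controlled in every order: \<open>conv f (\<kappa> j)\<close> is in L2 for all \<open>j\<close> as
  soon as \<open>f\<close> itself is.\<close>

lemma conv_nth_deriv:
  assumes "smooth f" "cauchy_bc f"
  shows "conv (nth_deriv i f) (\<kappa> j) = conv f (\<kappa> (i + j))"
proof (induction i arbitrary: j)
  case (Suc i)
  obtain M where M: "\<And>x. norm (nth_deriv i f x) \<le> M"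
    using smooth_decay_bounded[OF assms] by metis
  obtain M' where M': "\<And>x. norm (nth_deriv (Suc i) f x) \<le> M'"
    using smooth_decay_bounded[OF assms] by metis
  have "conv (nth_deriv (Suc i) f) (\<kappa> j) = conv (nth_deriv i f) (\<kappa> (Suc j))"
    by (intro ext conv_deriv_shift[OF _ _ M M'] smooth_has_vector_derivative smooth_continuous_on assms)
       (use assms in \<open>auto simp: cauchy_bc_def\<close>)
  then show ?case using Suc.IH by simp
qed simp

lemma conv_has_vector_derivative_Suc:
  assumes "smooth f" "cauchy_bc f"
  shows "(conv f (\<kappa> i) has_vector_derivative conv f (\<kappa> (Suc i)) x) (at x)"
proof -
  obtain M where M: "\<And>x. norm (nth_deriv i f x) \<le> M"
    using smooth_decay_bounded[OF assms] by metis
  obtain M' where M': "\<And>x. norm (nth_deriv (Suc i) f x) \<le> M'"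
    using smooth_decay_bounded[OF assms] by metis
  have "(conv (nth_deriv i f) (\<kappa> 0) has_vector_derivative conv (nth_deriv (Suc i) f) (\<kappa> 0) x) (at x)"
    by (intro conv_has_vector_derivative[OF _ _ M M' integrable] smooth_has_vector_derivative
        smooth_continuous_on assms)
  then show ?thesis
    by (simp add: conv_nth_deriv[OF assms])
qed

lemma conv_smooth_continuous:
  assumes "smooth f" "cauchy_bc f"
  shows "continuous_on UNIV (conv f (\<kappa> i))"
  by (meson conv_has_vector_derivative_Suc[OF assms] continuous_at_imp_continuous_on has_vector_derivative_continuous)

lemma conv_smooth_tendsto:
  assumes "smooth f" "cauchy_bc f"
  shows "(conv f (\<kappa> i) \<longlongrightarrow> 0) at_top" "(conv f (\<kappa> i) \<longlongrightarrow> 0) at_bot"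
proof -
  obtain M where M: "\<And>x. norm (nth_deriv 0 f x) \<le> M"
    using smooth_decay_bounded[OF assms] by metis
  have f: "f \<in> borel_measurable borel" "\<And>x. norm (f x) \<le> M" "(f \<longlongrightarrow> 0) at_top" "(f \<longlongrightarrow> 0) at_bot"
    using borel_measurable_nth_deriv[OF assms(1), of 0] M assms(2)[unfolded cauchy_bc_def, THEN spec, of 0]
    by auto
  show "(conv f (\<kappa> i) \<longlongrightarrow> 0) at_top" "(conv f (\<kappa> i) \<longlongrightarrow> 0) at_bot"
    using conv_tendsto_at_top[OF f(1,2) integrable f(3)] conv_tendsto_at_bot[OF f(1,2) integrable f(4)]
    by auto
qed

section \<open>Monotonicity of the L2 norms of the convolved partial sums\<close>

lemma conv_inner_shift:
  assumes f: "smooth f" "cauchy_bc f" "l2 f"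
  shows "(LINT x|lborel. conv f (\<kappa> (a + s)) x * cnj (conv f (\<kappa> b) x)) =
    (-1) ^ s * (LINT x|lborel. conv f (\<kappa> a) x * cnj (conv f (\<kappa> (b + s)) x))"
proof (induction s arbitrary: a b)
  case (Suc s)
  note tendsto = conv_smooth_tendsto[OF f(1,2)]
  have "((\<lambda>x. conv f (\<kappa> (a + s)) x * cnj (conv f (\<kappa> b) x)) \<longlongrightarrow> 0) F"
    if "F = at_top \<or> F = at_bot" for F
    using that tendsto_mult[OF tendsto(1) tendsto_cnj[OF tendsto(1)]]
      tendsto_mult[OF tendsto(2) tendsto_cnj[OF tendsto(2)]] by auto
  then have "(LINT x|lborel. conv f (\<kappa> (Suc (a + s))) x * cnj (conv f (\<kappa> b) x)) =
     - (LINT x|lborel. conv f (\<kappa> (a + s)) x * cnj (conv f (\<kappa> (Suc b)) x))"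
    by (intro integral_by_parts_line has_vector_derivative_cnj conv_has_vector_derivative_Suc f
        continuous_on_cnj conv_smooth_continuous l2_mult_integrable l2_cnj l2_conv) auto
  then show ?case using Suc.IH[of a "Suc b"] by simp
qed simp

text \<open>For \<open>k \<le> j\<close>, moving \<open>j - k\<close> derivatives across gives both
  factors the order \<open>j + k\<close>. The sign \<open>(-1) ^ (j - k)\<close> so produced cancels
  \<open>(-1) ^ (j + k)\<close> and leaves a squared L2 norm. The other case follows by complex
  conjugation.\<close>

lemma conv_inner_nonneg:
  assumes f: "smooth f" "cauchy_bc f" "l2 f"
  shows "Re ((-1) ^ (j + k) * (LINT x|lborel. conv f (\<kappa> (2 * j)) x * cnj (conv f (\<kappa> (2 * k)) x))) \<ge> 0"
proof -
  have *: "Re ((-1) ^ (j + k) * (LINT x|lborel. conv f (\<kappa> (2 * j)) x * cnj (conv f (\<kappa> (2 * k)) x))) \<ge> 0"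
    if "k \<le> j" for j k
  proof -
    have eq: "2 * j = (j + k) + (j - k)" "j + k = 2 * k + (j - k)" using that by auto
    have sgn: "(-1 :: complex) ^ (j + k) * (-1) ^ (j - k) = 1"
      using that by (simp flip: power_add)
    have "(LINT x|lborel. conv f (\<kappa> (2 * j)) x * cnj (conv f (\<kappa> (2 * k)) x)) =
      (-1) ^ (j - k) * (LINT x|lborel. conv f (\<kappa> (j + k)) x * cnj (conv f (\<kappa> (j + k)) x))"
      using conv_inner_shift[OF f, of "j + k" "j - k" "2 * k"] eq by metis
    also have "(LINT x|lborel. conv f (\<kappa> (j + k)) x * cnj (conv f (\<kappa> (j + k)) x)) =
      of_real (LINT x|lborel. (norm (conv f (\<kappa> (j + k)) x))\<^sup>2)"
      by (simp only: complex_norm_square[symmetric] integral_complex_of_real)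
    finally show ?thesis
      unfolding mult.assoc[symmetric] by (simp add: mult.assoc[symmetric] sgn)
  qed
  show ?thesis
  proof (cases "k \<le> j")
    case False
    then have "0 \<le> Re (cnj ((-1) ^ (k + j) * (LINT x|lborel. conv f (\<kappa> (2 * k)) x * cnj (conv f (\<kappa> (2 * j)) x))))"
      using *[of j k] by simp
    also have "cnj ((-1) ^ (k + j) * (LINT x|lborel. conv f (\<kappa> (2 * k)) x * cnj (conv f (\<kappa> (2 * j)) x))) =
      (-1) ^ (j + k) * (LINT x|lborel. conv f (\<kappa> (2 * j)) x * cnj (conv f (\<kappa> (2 * k)) x))"
      by (subst complex_cnj_mult, subst Bochner_Integration.integral_cnj[symmetric]) (simp add: add.commute mult.commute)
    finally show ?thesis .
  qed (rule *)
qed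

text \<open>The convolution of \<open>\<kappa> 0\<close> with a partial sum of the operator series,
  all derivatives being carried by the kernel; see \<open>conv_partial_eq\<close>.\<close>

definition conv_partial :: "(nat \<Rightarrow> real) \<Rightarrow> (real \<Rightarrow> complex) \<Rightarrow> nat \<Rightarrow> real \<Rightarrow> complex" where
  "conv_partial v f N x = (\<Sum>k<N. (-1) ^ k * of_real (v k) * conv f (\<kappa> (2 * k)) x)"

lemma conv_partial_eq:
  assumes "smooth f" "cauchy_bc f"
  shows "conv (\<lambda>x. \<Sum>k<N. sobolev_op_term v f k x) (\<kappa> 0) = conv_partial v f N"
proof
  fix x
  have int: "integrable lborel (\<lambda>y. sobolev_op_term v f k y * of_real (\<kappa> 0 (x - y)))" for k
  proof -
    obtain M where "\<And>x. norm (nth_deriv (2 * k) f x) \<le> M"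
      using smooth_decay_bounded[OF assms] by metis
    then have "integrable lborel (\<lambda>y. nth_deriv (2 * k) f y * of_real (\<kappa> 0 (x - y)))"
      by (intro conv_integrable borel_measurable_nth_deriv assms)
    then show ?thesis
      by (simp add: sobolev_op_term_def mult.assoc)
  qed
  have "conv (\<lambda>x. \<Sum>k<N. sobolev_op_term v f k x) (\<kappa> 0) x =
      (\<Sum>k<N. (LINT y|lborel. sobolev_op_term v f k y * of_real (\<kappa> 0 (x - y))))"
    unfolding conv_def sum_distrib_right using int by simp
  also have "\<dots> = (\<Sum>k<N. (-1) ^ k * of_real (v k) * conv (nth_deriv (2 * k) f) (\<kappa> 0) x)"
    by (simp add: sobolev_op_term_def conv_def mult.assoc)
  finally show "conv (\<lambda>x. \<Sum>k<N. sobolev_op_term v f k x) (\<kappa> 0) x = conv_partial v f N x"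
    by (simp add: conv_partial_def conv_nth_deriv[OF assms])
qed

text \<open>The new term is written as a subtraction so that \<open>l2_diff_scale\<close>
  applies.\<close>

lemma conv_partial_Suc:
  "conv_partial v f (Suc N) = (\<lambda>x. conv_partial v f N x - (- ((-1) ^ N * of_real (v N))) * conv f (\<kappa> (2 * N)) x)"
  by (simp add: conv_partial_def fun_eq_iff)

lemma l2_conv_partial: "l2 f \<Longrightarrow> l2 (conv_partial v f N)"
proof (induction N)
  case (Suc N)
  then show ?case unfolding conv_partial_Suc by (intro l2_diff_scale l2_conv)
qed (simp add: conv_partial_def[abs_def] l2_def)

text \<open>When the squared norm of \<open>w + a\<close> is expanded, the cross term is a
  combination of the inner products of \<open>conv_inner_nonneg\<close> with weights
  \<open>v k * v N \<ge> 0\<close>, hence nonnegative.\<close>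

lemma conv_partial_norm_mono:
  assumes f: "smooth f" "cauchy_bc f" "l2 f" and v: "\<And>k. v k \<ge> 0"
  shows "(LINT x|lborel. (norm (conv_partial v f N x))\<^sup>2) \<le> (LINT x|lborel. (norm (conv_partial v f (Suc N) x))\<^sup>2)"
proof -
  define w where "w = conv_partial v f N"
  define a where "a x = (-1) ^ N * of_real (v N) * conv f (\<kappa> (2 * N)) x" for x
  have w: "l2 w" and a: "l2 a"
    unfolding w_def a_def[abs_def] by (intro l2_conv_partial l2_scale l2_conv f)+
  have wa: "conv_partial v f (Suc N) x = w x + a x" for x
    by (simp add: w_def a_def conv_partial_def)
  have ii: "integrable lborel (\<lambda>x. conv f (\<kappa> i) x * cnj (conv f (\<kappa> j) x))" for i j
    by (intro l2_mult_integrable l2_cnj l2_conv f)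
  have "(LINT x|lborel. w x * cnj (a x)) =
      (LINT x|lborel. (\<Sum>k<N. of_real (v k * v N) * ((-1) ^ (k + N) * (conv f (\<kappa> (2 * k)) x * cnj (conv f (\<kappa> (2 * N)) x)))))"
    unfolding w_def a_def conv_partial_def sum_distrib_right
    by (intro Bochner_Integration.integral_cong sum.cong) (auto simp: power_add)
  also have "\<dots> = (\<Sum>k<N. of_real (v k * v N) * ((-1) ^ (k + N) *
      (LINT x|lborel. conv f (\<kappa> (2 * k)) x * cnj (conv f (\<kappa> (2 * N)) x))))"
    using ii by (subst Bochner_Integration.integral_sum) auto
  finally have "Re (LINT x|lborel. w x * cnj (a x)) = (\<Sum>k<N. (v k * v N) * Re ((-1) ^ (k + N) *
      (LINT x|lborel. conv f (\<kappa> (2 * k)) x * cnj (conv f (\<kappa> (2 * N)) x))))"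
    by (simp only: Re_sum) simp
  also have "\<dots> \<ge> 0"
    by (intro sum_nonneg mult_nonneg_nonneg v conv_inner_nonneg f)
  finally have cross: "(LINT x|lborel. Re (w x * cnj (a x))) \<ge> 0"
    by (simp only: integral_Re[OF l2_mult_integrable[OF w l2_cnj[OF a]]])
  have "(LINT x|lborel. (norm (w x))\<^sup>2) \<le> (LINT x|lborel. (norm (w x))\<^sup>2) + (LINT x|lborel. (norm (a x))\<^sup>2)
      + 2 * (LINT x|lborel. Re (w x * cnj (a x)))"
    using cross integral_nonneg_AE[of "\<lambda>x. (norm (a x))\<^sup>2" lborel] by simp
  also have "\<dots> = (LINT x|lborel. (norm (w x))\<^sup>2 + (norm (a x))\<^sup>2 + 2 * Re (w x * cnj (a x)))"
    using w a integrable_Re[OF l2_mult_integrable[OF w l2_cnj[OF a]]] by (simp add: l2_def del: times_complex.sel)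
  also have "\<dots> = (LINT x|lborel. (norm (w x + a x))\<^sup>2)"
    by (intro Bochner_Integration.integral_cong refl)
       (simp only: cmod_power2, simp add: power2_eq_square algebra_simps)
  finally show ?thesis
    by (simp add: wa w_def)
qed

text \<open>Separates \<open>k\<close> from \<open>x\<close>: up to the factor
  \<open>B * A ^ k\<close>, a single function of \<open>x\<close>, in L2 when \<open>f\<close> is,
  dominates the convolutions with all the \<open>\<kappa> k\<close>.\<close>

lemma norm_conv_le:
  assumes f: "f \<in> borel_measurable borel" "\<And>y. norm (f y) \<le> M"
  shows "norm (conv f (\<kappa> k) x) \<le> B * A ^ k * norm (conv (\<lambda>y. of_real (norm (f y))) (\<lambda>y. 1 / (1 + y\<^sup>2)) x)"
proof -
  let ?h = "\<lambda>y::real. 1 / (1 + y\<^sup>2)"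
  have "integrable lborel (\<lambda>y. f y * of_real (?h (x - y)))"
    by (rule conv_bounded_integrable[OF f integrable_inverse_1_plus_square])
  from integrable_norm[OF this] have int: "integrable lborel (\<lambda>y. norm (f y) * ?h (x - y))"
    by (simp add: norm_mult norm_divide abs_of_pos add_pos_nonneg flip: of_real_power of_real_add of_real_diff)
  have "norm (conv f (\<kappa> k) x) \<le> (LINT y|lborel. norm (f y * of_real (\<kappa> k (x - y))))"
    unfolding conv_def by (rule integral_norm_bound)
  also have "\<dots> \<le> (LINT y|lborel. B * A ^ k * (norm (f y) * ?h (x - y)))"
  proof (rule integral_mono)
    show "integrable lborel (\<lambda>y. norm (f y * of_real (\<kappa> k (x - y))))"
      by (rule integrable_norm[OF conv_integrable[OF f]])
    show "integrable lborel (\<lambda>y. B * A ^ k * (norm (f y) * ?h (x - y)))"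
      using int by (rule integrable_mult_right)
    show "norm (f y * of_real (\<kappa> k (x - y))) \<le> B * A ^ k * (norm (f y) * ?h (x - y))" for y
      using mult_left_mono[OF bound[of k "x - y"], of "norm (f y)"]
      by (simp add: norm_mult mult_ac)
  qed
  also have "\<dots> = B * A ^ k * (LINT y|lborel. norm (f y) * ?h (x - y))"
    by (rule integral_mult_right_zero)
  also have "(LINT y|lborel. norm (f y) * ?h (x - y)) \<le> norm (conv (\<lambda>y. of_real (norm (f y))) ?h x)"
    unfolding conv_def of_real_mult[symmetric] integral_complex_of_real norm_of_real by simp
  finally show ?thesis
    using B_nonneg A_pos by (simp add: mult_left_mono)
qed

text \<open>All partial sums are dominated by a constant times \<open>norm (u x)\<close>, where
  \<open>u\<close> is in L2 and the constant contains the sum of \<open>v k * A ^ (2 * k)\<close>.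
  Comparison gives summability. Dominated convergence makes the squared norms of the partial sums
  converge to that of \<open>g\<close>, and since they increase, none exceeds the limit.\<close>

lemma
  assumes f: "smooth f" "cauchy_bc f" "l2 f" and v: "\<And>k. v k \<ge> 0" "summable (\<lambda>k. v k * A ^ (2 * k))"
  shows conv_series_summable: "summable (\<lambda>k. (-1) ^ k * of_real (v k) * conv f (\<kappa> (2 * k)) x)"
    and conv_partial_norm_le: "(\<And>x. (\<lambda>N. conv_partial v f N x) \<longlonglongrightarrow> g x) \<Longrightarrow>
      (LINT x|lborel. (norm (conv_partial v f N x))\<^sup>2) \<le> (LINT x|lborel. (norm (g x))\<^sup>2)"
proof -
  let ?h = "\<lambda>y::real. 1 / (1 + y\<^sup>2)"
  obtain M where M: "\<And>x. norm (nth_deriv 0 f x) \<le> M"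
    using smooth_decay_bounded[OF f(1,2)] by metis
  have fm [measurable]: "f \<in> borel_measurable borel"
    using f by (simp add: l2_def)
  define u where "u = conv (\<lambda>y. of_real (norm (f y))) ?h"
  have u: "l2 u" unfolding u_def
  proof (rule conv_l2(1)[OF _ _ integrable_inverse_1_plus_square, where N = "(LINT y|lborel. \<bar>?h y\<bar>) + 1"])
    show "l2 (\<lambda>y. complex_of_real (norm (f y)))"
      using f by (simp add: l2_def)
    show "\<bar>?h y\<bar> \<le> 1" for y by (simp add: abs_of_pos add_pos_nonneg)
    show "(LINT y|lborel. \<bar>?h y\<bar>) + 1 > 0"
      by (intro add_nonneg_pos integral_nonneg_AE) auto
  qed auto
  have term_le: "norm ((-1) ^ k * of_real (v k) * conv f (\<kappa> (2 * k)) x) \<le> B * norm (u x) * (v k * A ^ (2 * k))" for k x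
  proof -
    have "norm ((-1) ^ k * of_real (v k) * conv f (\<kappa> (2 * k)) x) = v k * norm (conv f (\<kappa> (2 * k)) x)"
      using v(1)[of k] by (simp add: norm_mult norm_power)
    also have "\<dots> \<le> v k * (B * A ^ (2 * k) * norm (u x))"
      unfolding u_def by (intro mult_left_mono norm_conv_le[OF fm M[unfolded nth_deriv_0]] v(1))
    finally show ?thesis by (simp only: mult_ac)
  qed
  show "summable (\<lambda>k. (-1) ^ k * of_real (v k) * conv f (\<kappa> (2 * k)) x)"
    by (rule summable_comparison_test'[OF summable_mult[OF v(2), of "B * norm (u x)"] term_le])
  assume g: "\<And>x. (\<lambda>N. conv_partial v f N x) \<longlonglongrightarrow> g x"
  define K where "K = B * (\<Sum>k. v k * A ^ (2 * k))"
  have part: "norm (conv_partial v f N x) \<le> K * norm (u x)" for N x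
  proof -
    have "norm (conv_partial v f N x) \<le> (\<Sum>k<N. B * norm (u x) * (v k * A ^ (2 * k)))"
      unfolding conv_partial_def by (intro sum_norm_le term_le)
    also have "\<dots> = B * norm (u x) * (\<Sum>k<N. v k * A ^ (2 * k))"
      by (simp add: sum_distrib_left)
    also have "\<dots> \<le> B * norm (u x) * (\<Sum>k. v k * A ^ (2 * k))"
      using v A_pos B_nonneg by (intro mult_left_mono sum_le_suminf) auto
    finally show ?thesis by (simp only: K_def mult_ac)
  qed
  have [measurable]: "conv_partial v f N \<in> borel_measurable borel" for N
    using l2_conv_partial[OF f(3)] by (simp add: l2_def)
  have gm [measurable]: "g \<in> borel_measurable borel"
    by (rule borel_measurable_LIMSEQ_metric[OF _ g]) simp
  have "(\<lambda>N. (LINT x|lborel. (norm (conv_partial v f N x))\<^sup>2)) \<longlonglongrightarrow> (LINT x|lborel. (norm (g x))\<^sup>2)"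
  proof (rule integral_dominated_convergence[where w = "\<lambda>x. K\<^sup>2 * (norm (u x))\<^sup>2"])
    show "integrable lborel (\<lambda>x. K\<^sup>2 * (norm (u x))\<^sup>2)" using u by (simp add: l2_def)
    show "AE x in lborel. (\<lambda>N. (norm (conv_partial v f N x))\<^sup>2) \<longlonglongrightarrow> (norm (g x))\<^sup>2"
      by (intro AE_I2 tendsto_power tendsto_norm g)
    have "(norm (conv_partial v f N x))\<^sup>2 \<le> (K * norm (u x))\<^sup>2" for N x
      by (intro power_mono part) auto
    then show "AE x in lborel. norm ((norm (conv_partial v f N x))\<^sup>2) \<le> K\<^sup>2 * (norm (u x))\<^sup>2" for N
      by (simp add: power_mult_distrib)
  qed measurable
  moreover have "incseq (\<lambda>N. (LINT x|lborel. (norm (conv_partial v f N x))\<^sup>2))"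
    by (rule incseq_SucI) (rule conv_partial_norm_mono[OF f v(1)])
  ultimately show "(LINT x|lborel. (norm (conv_partial v f N x))\<^sup>2) \<le> (LINT x|lborel. (norm (g x))\<^sup>2)"
    by (rule incseq_le[rotated])
qed

end

subsection \<open>The weak equation\<close>

text \<open>For smooth members of the space this is \<open>sobolev_inner v f f\<close> as a real
  number, with the integrals already taken over \<open>lborel\<close>.\<close>

definition sobolev_sqnorm :: "(nat \<Rightarrow> real) \<Rightarrow> (real \<Rightarrow> complex) \<Rightarrow> real" where
  "sobolev_sqnorm v f = (\<Sum>k. v k * (LINT x|lborel. (norm (nth_deriv k f x))\<^sup>2))"

lemma smooth_sobolev_space_iff:
  assumes "smooth f"
  shows "f \<in> sobolev_space v \<longleftrightarrow> (\<forall>k. v k \<noteq> 0 \<longrightarrow> l2 (nth_deriv k f)) \<and>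
    summable (\<lambda>k. v k * (LINT x|lborel. (norm (nth_deriv k f x))\<^sup>2))"
proof -
  have "(LINT x|lebesgue. (norm (nth_deriv k f x))\<^sup>2) = (LINT x|lborel. (norm (nth_deriv k f x))\<^sup>2)" for k
    by (intro lebesgue_integral_eq_lborel continuous_intros smooth_continuous_on assms)
  then show ?thesis
    unfolding sobolev_space_def
    by (simp add: smooth_has_sobolev_deriv square_integrable_iff_l2 smooth_continuous_on assms)
qed

lemma smooth_sobolev_inner:
  assumes "smooth f" "smooth g"
  shows "sobolev_inner v f g = (\<Sum>k. of_real (v k) * (LINT x|lborel. nth_deriv k f x * cnj (nth_deriv k g x)))"
proof -
  have "(LINT x|lebesgue. nth_deriv k f x * cnj (nth_deriv k g x)) =
      (LINT x|lborel. nth_deriv k f x * cnj (nth_deriv k g x))" for k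
    by (intro lebesgue_integral_eq_lborel continuous_intros smooth_continuous_on assms continuous_on_cnj)
  then show ?thesis by (simp add: sobolev_inner_def)
qed

context
  fixes v :: "nat \<Rightarrow> real"
  assumes v_nonneg: "\<And>k. v k \<ge> 0"
begin

text \<open>Weighted Cauchy-Schwarz in each order. Where \<open>v k = 0\<close> the
  \<open>k\<close>-th derivatives may fail to be square integrable, but then both sides are
  0.\<close>

lemma sobolev_term_bound:
  assumes f: "smooth f" "f \<in> sobolev_space v" and g: "smooth g" "g \<in> sobolev_space v" and e: "e > 0"
  shows "norm (of_real (v k) * (LINT x|lborel. nth_deriv k f x * cnj (nth_deriv k g x))) \<le>
    (e * (v k * (LINT x|lborel. (norm (nth_deriv k f x))\<^sup>2)) +
     (v k * (LINT x|lborel. (norm (nth_deriv k g x))\<^sup>2)) / e) / 2"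
proof (cases "v k = 0")
  case False
  then have "l2 (nth_deriv k f)" "l2 (nth_deriv k g)"
    using f g by (auto simp: smooth_sobolev_space_iff)
  from mult_left_mono[OF l2_mult_cnj_bound[OF this e] v_nonneg[of k]] show ?thesis
    using v_nonneg[of k] by (simp add: norm_mult algebra_simps)
qed simp

lemma sobolev_inner_summable:
  assumes f: "smooth f" "f \<in> sobolev_space v" and g: "smooth g" "g \<in> sobolev_space v"
  shows "summable (\<lambda>k. of_real (v k) * (LINT x|lborel. nth_deriv k f x * cnj (nth_deriv k g x)))"
  by (rule summable_comparison_test'[OF _ sobolev_term_bound[OF f g zero_less_one]])
     (use f g in \<open>auto simp: smooth_sobolev_space_iff intro!: summable_divide summable_add\<close>)

lemma norm_sobolev_inner_le:
  assumes f: "smooth f" "f \<in> sobolev_space v" and g: "smooth g" "g \<in> sobolev_space v" and e: "e > 0"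
  shows "norm (sobolev_inner v f g) \<le> (e * sobolev_sqnorm v f + sobolev_sqnorm v g / e) / 2"
proof -
  define a where "a k = v k * (LINT x|lborel. (norm (nth_deriv k f x))\<^sup>2)" for k
  define b where "b k = v k * (LINT x|lborel. (norm (nth_deriv k g x))\<^sup>2)" for k
  have ab: "summable a" "summable b"
    using f g unfolding a_def[abs_def] b_def[abs_def] by (auto simp: smooth_sobolev_space_iff)
  have "norm (of_real (v k) * (LINT x|lborel. nth_deriv k f x * cnj (nth_deriv k g x))) \<le> (e * a k + b k / e) / 2" for k
    unfolding a_def b_def by (rule sobolev_term_bound[OF f g e])
  moreover have "summable (\<lambda>k. (e * a k + b k / e) / 2)"
    by (intro summable_divide summable_add summable_mult ab)
  ultimately have "norm (sobolev_inner v f g) \<le> (\<Sum>k. (e * a k + b k / e) / 2)"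
    unfolding smooth_sobolev_inner[OF f(1) g(1)] by (rule norm_suminf_le)
  also have "\<dots> = (e * suminf a + suminf b / e) / 2"
    using ab by (simp add: suminf_divide suminf_add[symmetric] suminf_mult summable_divide summable_add summable_mult)
  finally show ?thesis
    by (simp add: sobolev_sqnorm_def a_def[abs_def] b_def[abs_def])
qed

lemma sobolev_inner_self:
  assumes f: "smooth f" "f \<in> sobolev_space v"
  shows "sobolev_inner v f f = of_real (sobolev_sqnorm v f)"
proof -
  have "(LINT x|lborel. nth_deriv k f x * cnj (nth_deriv k f x)) = of_real (LINT x|lborel. (norm (nth_deriv k f x))\<^sup>2)" for k
    by (simp only: complex_norm_square[symmetric] integral_complex_of_real)
  then show ?thesis
    unfolding smooth_sobolev_inner[OF f(1) f(1)] sobolev_sqnorm_def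
    using f by (simp add: smooth_sobolev_space_iff suminf_of_real del: of_real_mult flip: of_real_mult)
qed

lemma sobolev_space_diff_scale:
  assumes f: "smooth f" "f \<in> sobolev_space v" and g: "smooth g" "g \<in> sobolev_space v"
  shows "(\<lambda>x. f x - c * g x) \<in> sobolev_space v"
proof -
  define N where "N f k = (LINT x|lborel. (norm (nth_deriv k f x))\<^sup>2)" for f k
  have l2: "l2 (nth_deriv k (\<lambda>x. f x - c * g x))" "l2 (nth_deriv k f)" "l2 (nth_deriv k g)" if "v k \<noteq> 0" for k
    unfolding nth_deriv_diff_scale[OF f(1) g(1)]
    using f g that by (auto simp: smooth_sobolev_space_iff intro!: l2_diff_scale)
  have le: "norm (v k * N (\<lambda>x. f x - c * g x) k) \<le> 2 * (v k * N f k) + 2 * (norm c)\<^sup>2 * (v k * N g k)" for k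
  proof (cases "v k = 0")
    case False
    note l2 = l2[OF this, unfolded l2_def, THEN conjunct2]
    have "N (\<lambda>x. f x - c * g x) k \<le>
        (LINT x|lborel. 2 * (norm (nth_deriv k f x))\<^sup>2 + 2 * (norm c)\<^sup>2 * (norm (nth_deriv k g x))\<^sup>2)"
      unfolding N_def
    proof (rule integral_mono)
      show "(norm (nth_deriv k (\<lambda>x. f x - c * g x) x))\<^sup>2 \<le>
          2 * (norm (nth_deriv k f x))\<^sup>2 + 2 * (norm c)\<^sup>2 * (norm (nth_deriv k g x))\<^sup>2" for x
        unfolding nth_deriv_diff_scale[OF f(1) g(1)]
        using norm_minus_square_le[of "nth_deriv k f x" "c * nth_deriv k g x"]
        by (simp add: norm_mult power_mult_distrib)
    qed (use l2 in auto)
    also have "\<dots> = 2 * N f k + 2 * (norm c)\<^sup>2 * N g k"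
      unfolding N_def using l2 by simp
    finally have "v k * N (\<lambda>x. f x - c * g x) k \<le> v k * (2 * N f k + 2 * (norm c)\<^sup>2 * N g k)"
      by (intro mult_left_mono v_nonneg)
    moreover have "v k * N (\<lambda>x. f x - c * g x) k \<ge> 0"
      unfolding N_def by (intro mult_nonneg_nonneg v_nonneg integral_nonneg_AE) auto
    ultimately show ?thesis by (simp add: algebra_simps)
  qed simp
  have "summable (\<lambda>k. v k * N f k)" "summable (\<lambda>k. v k * N g k)"
    using f g by (auto simp: smooth_sobolev_space_iff N_def)
  then have "summable (\<lambda>k. v k * N (\<lambda>x. f x - c * g x) k)"
    by (intro summable_comparison_test'[OF _ le] summable_add summable_mult)
  then show ?thesis
    using l2(1) unfolding smooth_sobolev_space_iff[OF smooth_diff_scale[OF f(1) g(1)]] N_def by auto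
qed

lemma sobolev_inner_diff_scale:
  assumes f: "smooth f" "f \<in> sobolev_space v" and g: "smooth g" "g \<in> sobolev_space v"
    and h: "smooth h" "h \<in> sobolev_space v"
  shows "sobolev_inner v h (\<lambda>x. f x - c * g x) = sobolev_inner v h f - cnj c * sobolev_inner v h g"
proof -
  define I where "I f k = of_real (v k) * (LINT x|lborel. nth_deriv k h x * cnj (nth_deriv k f x))" for f k
  have "I (\<lambda>x. f x - c * g x) k = I f k - cnj c * I g k" for k
  proof (cases "v k = 0")
    case False
    then have l2: "l2 (nth_deriv k f)" "l2 (nth_deriv k g)" "l2 (nth_deriv k h)"
      using f g h by (auto simp: smooth_sobolev_space_iff)
    note int = l2_mult_integrable[OF l2(3) l2_cnj[OF l2(1)]] l2_mult_integrable[OF l2(3) l2_cnj[OF l2(2)]]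
    have "(LINT x|lborel. nth_deriv k h x * cnj (nth_deriv k (\<lambda>x. f x - c * g x) x)) =
       (LINT x|lborel. nth_deriv k h x * cnj (nth_deriv k f x) - cnj c * (nth_deriv k h x * cnj (nth_deriv k g x)))"
      unfolding nth_deriv_diff_scale[OF f(1) g(1)]
      by (intro Bochner_Integration.integral_cong) (simp_all add: algebra_simps)
    also have "\<dots> = (LINT x|lborel. nth_deriv k h x * cnj (nth_deriv k f x)) -
        cnj c * (LINT x|lborel. nth_deriv k h x * cnj (nth_deriv k g x))"
      using int by simp
    finally show ?thesis
      unfolding I_def by (simp only: right_diff_distrib mult.left_commute)
  qed (simp add: I_def)
  then have "I (\<lambda>x. f x - c * g x) = (\<lambda>k. I f k - cnj c * I g k)" ..
  moreover have "summable (I f)" "summable (I g)"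
    unfolding I_def[abs_def] by (intro sobolev_inner_summable f g h)+
  ultimately have "I (\<lambda>x. f x - c * g x) sums (suminf (I f) - cnj c * suminf (I g))"
    using sums_diff[OF summable_sums sums_mult[OF summable_sums], of "I f" "I g" "cnj c"] by simp
  from sums_unique[OF this] have "suminf (I (\<lambda>x. f x - c * g x)) = suminf (I f) - cnj c * suminf (I g)" ..
  then show ?thesis
    by (simp add: smooth_sobolev_inner f g h smooth_diff_scale I_def[abs_def])
qed

lemma l2_integral_le_sobolev_sqnorm:
  assumes "smooth f" "f \<in> sobolev_space v"
  shows "v 0 * (LINT x|lborel. (norm (f x))\<^sup>2) \<le> sobolev_sqnorm v f"
proof -
  have "(\<Sum>k\<in>{0}. v k * (LINT x|lborel. (norm (nth_deriv k f x))\<^sup>2)) \<le> sobolev_sqnorm v f"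
    unfolding sobolev_sqnorm_def using assms
    by (intro sum_le_suminf) (auto simp: smooth_sobolev_space_iff intro!: mult_nonneg_nonneg v_nonneg integral_nonneg_AE)
  then show ?thesis by simp
qed

text \<open>Both sides are continuous antilinear functionals of \<open>f\<close> and agree on the basis.\<close>

lemma weak_equation:
  assumes basis: "complete_orthonormal_basis v \<phi>" and smooth: "\<And>n. smooth (\<phi> n)"
    and v0: "v 0 > 0" and G: "l2 G"
    and coeff: "\<And>n. (LINT x|lborel. G x * cnj (\<phi> n x)) = (if m = n then l else 0)"
    and f: "smooth f" "f \<in> sobolev_space v"
  shows "(LINT x|lborel. G x * cnj (f x)) = l * sobolev_inner v (\<phi> m) f"
proof -
  have mem: "\<phi> n \<in> sobolev_space v" for n
    using basis by (simp add: complete_orthonormal_basis_def)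
  have ortho: "sobolev_inner v (\<phi> i) (\<phi> j) = (if i = j then 1 else 0)" for i j
    using basis by (simp add: complete_orthonormal_basis_def)
  have f_l2: "l2 g" if "smooth g" "g \<in> sobolev_space v" for g
    using that v0 by (auto simp: smooth_sobolev_space_iff dest: spec[of _ 0])
  define T where "T g = (LINT x|lborel. G x * cnj (g x)) - l * sobolev_inner v (\<phi> m) g" for g
  \<comment> \<open>\<open>T\<close> vanishes on the basis by \<open>coeff\<close> and
    \<open>ortho\<close>, so \<open>T f\<close> equals \<open>T\<close> of every remainder of
    \<open>f\<close>, and completeness makes remainders small.\<close>
  have T_step: "T (\<lambda>x. g x - c * \<phi> n x) = T g" if g: "smooth g" "g \<in> sobolev_space v" for g c n
  proof -
    note int = l2_mult_integrable[OF G l2_cnj[OF f_l2[OF g]]]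
      l2_mult_integrable[OF G l2_cnj[OF f_l2[OF smooth mem[of n]]]]
    have "(LINT x|lborel. G x * cnj (g x - c * \<phi> n x)) =
       (LINT x|lborel. G x * cnj (g x) - cnj c * (G x * cnj (\<phi> n x)))"
      by (intro Bochner_Integration.integral_cong) (simp_all add: algebra_simps)
    also have "\<dots> = (LINT x|lborel. G x * cnj (g x)) - cnj c * (LINT x|lborel. G x * cnj (\<phi> n x))"
      using int by simp
    finally have eq: "(LINT x|lborel. G x * cnj (g x - c * \<phi> n x)) =
        (LINT x|lborel. G x * cnj (g x)) - cnj c * (LINT x|lborel. G x * cnj (\<phi> n x))" .
    show ?thesis
      unfolding T_def sobolev_inner_diff_scale[OF g smooth mem smooth mem] eq coeff ortho
      by (simp add: right_diff_distrib)
  qed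
  have partial: "smooth (\<lambda>x. f x - (\<Sum>n<N. c n * \<phi> n x)) \<and>
      (\<lambda>x. f x - (\<Sum>n<N. c n * \<phi> n x)) \<in> sobolev_space v \<and>
      T (\<lambda>x. f x - (\<Sum>n<N. c n * \<phi> n x)) = T f" for N c
  proof (induction N)
    case (Suc N)
    have "(\<lambda>x. f x - (\<Sum>n<Suc N. c n * \<phi> n x)) = (\<lambda>x. (f x - (\<Sum>n<N. c n * \<phi> n x)) - c N * \<phi> N x)"
      by auto
    then show ?case
      using Suc.IH T_step smooth_diff_scale[OF _ smooth] sobolev_space_diff_scale[OF _ _ smooth mem]
      by presburger
  qed (use f in simp)
  \<comment> \<open>Collects the estimates for a remainder of norm below \<open>e\<close>, with
    \<open>e\<close> also serving as the weight in the Cauchy-Schwarz bounds: the integral against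
    \<open>G\<close> contributes the first two summands, the Sobolev inner product, of modulus at
    most \<open>e\<close>, the last.\<close>
  define C where "C = ((LINT x|lborel. (norm (G x))\<^sup>2) + 1 / v 0 + norm l * 2) / 2"
  have C: "C \<ge> 0"
    unfolding C_def using v0 by (auto intro!: add_nonneg_nonneg integral_nonneg_AE)
  have "norm (T f) \<le> e * C" if e: "e > 0" for e
  proof -
    obtain N c where N: "sobolev_norm v (\<lambda>x. f x - (\<Sum>n<N. c n * \<phi> n x)) < e"
      using basis[unfolded complete_orthonormal_basis_def, THEN conjunct2, THEN conjunct2, THEN bspec, OF f(2)] e
      by blast
    define d where "d = (\<lambda>x. f x - (\<Sum>n<N. c n * \<phi> n x))"
    have d: "smooth d" "d \<in> sobolev_space v" "T d = T f"
      using partial by (auto simp: d_def)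
    have "sqrt (sobolev_sqnorm v d) \<le> e"
      using N by (simp add: sobolev_norm_def d_def[symmetric] sobolev_inner_self[OF d(1,2)])
    then have sq: "sobolev_sqnorm v d \<le> e\<^sup>2"
      using e by (simp add: sqrt_le_D)
    then have "v 0 * (LINT x|lborel. (norm (d x))\<^sup>2) \<le> e\<^sup>2"
      using l2_integral_le_sobolev_sqnorm[OF d(1,2)] by simp
    then have d2: "(LINT x|lborel. (norm (d x))\<^sup>2) / e \<le> e / v 0"
      using v0 e by (simp add: field_simps power2_eq_square)
    have m1: "sobolev_sqnorm v (\<phi> m) = 1"
      using ortho[of m m] sobolev_inner_self[OF smooth[of m] mem] by simp
    have "norm (LINT x|lborel. G x * cnj (d x)) \<le> (e * (LINT x|lborel. (norm (G x))\<^sup>2) + e / v 0) / 2"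
      using l2_mult_cnj_bound[OF G f_l2[OF d(1,2)] e] d2 by simp
    moreover have "norm (sobolev_inner v (\<phi> m) d) \<le> e"
    proof -
      have "norm (sobolev_inner v (\<phi> m) d) \<le> (e * 1 + sobolev_sqnorm v d / e) / 2"
        using norm_sobolev_inner_le[OF smooth mem d(1,2) e, of m] by (simp add: m1)
      also have "sobolev_sqnorm v d / e \<le> e"
        using sq e by (simp add: pos_divide_le_eq power2_eq_square)
      finally show ?thesis by simp
    qed
    then have "norm (l * sobolev_inner v (\<phi> m) d) \<le> norm l * e"
      by (simp add: norm_mult mult_left_mono)
    ultimately have "norm (T d) \<le> (e * (LINT x|lborel. (norm (G x))\<^sup>2) + e / v 0) / 2 + norm l * e"
      unfolding T_def by (intro order_trans[OF norm_triangle_ineq4] add_mono)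
    also have "\<dots> = e * C"
      by (simp add: C_def algebra_simps)
    finally show ?thesis using d(3) by simp
  qed
  note small = this
  have "norm (T f) \<le> 0 + e" if "e > 0" for e
  proof -
    \<comment> \<open>Dividing by \<open>C + 1\<close> is safe, as \<open>C\<close> is only known to
      be nonnegative.\<close>
    have "norm (T f) \<le> e / (C + 1) * C"
      using small[of "e / (C + 1)"] that C by simp
    also have "\<dots> \<le> e"
      using that C by (simp add: field_simps)
    finally show ?thesis by simp
  qed
  then have "norm (T f) \<le> 0"
    by (rule field_le_epsilon)
  then show ?thesis by (simp add: T_def)
qed

end

section \<open>Translates of the kernel as test functions\<close>

context decaying_kernel begin

context
  fixes x :: real
begin

lemma reflected_deriv:
  "((\<lambda>y. complex_of_real ((-1) ^ k * \<kappa> k (x - y))) has_vector_derivative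
    of_real ((-1) ^ Suc k * \<kappa> (Suc k) (x - y))) (at y)"
  using has_vector_derivative_mult_right[OF reflected_has_vector_derivative[of k x y], of "(-1) ^ k"] by simp

lemma smooth_reflected: "smooth (\<lambda>y. complex_of_real (\<kappa> 0 (x - y)))"
  by (rule smoothI[of "\<lambda>k y. complex_of_real ((-1) ^ k * \<kappa> k (x - y))"]) (simp, rule reflected_deriv)

lemma nth_deriv_reflected:
  "nth_deriv k (\<lambda>y. complex_of_real (\<kappa> 0 (x - y))) = (\<lambda>y. of_real ((-1) ^ k * \<kappa> k (x - y)))"
  by (rule nth_deriv_eqI) (simp, rule reflected_deriv)

text \<open>In the square of the \<open>k\<close>-th derivative one factor is bounded by
  \<open>B * A ^ k\<close> uniformly, the other with its decay. So the squared L2 norm is at most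
  \<open>B\<^sup>2 * H * A ^ (2 * k)\<close>, and the Sobolev series is compared with the power
  series of \<open>v\<close> at \<open>A\<close>.\<close>

lemma reflected_sobolev_space:
  assumes v: "\<And>k. v k \<ge> 0" "summable (\<lambda>k. v k * A ^ (2 * k))"
  shows "(\<lambda>y. complex_of_real (\<kappa> 0 (x - y))) \<in> sobolev_space v"
proof -
  define H where "H = (LINT y|lborel. 1 / (1 + (y::real)\<^sup>2))"
  have l2: "l2 (\<lambda>y. complex_of_real (\<kappa> k (x - y)))" for k
    by (rule l2_of_real_bounded_integrable[OF measurable integrable bounded])
  have eq: "nth_deriv k (\<lambda>y. complex_of_real (\<kappa> 0 (x - y))) = (\<lambda>y. (-1) ^ k * of_real (\<kappa> k (x - y)))" for k
    by (simp add: nth_deriv_reflected)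
  have nn: "(norm (nth_deriv k (\<lambda>y. complex_of_real (\<kappa> 0 (x - y))) y))\<^sup>2 = (\<kappa> k (x - y))\<^sup>2" for k y
    by (simp add: eq norm_mult norm_power)
  have "norm (v k * (LINT y|lborel. (norm (nth_deriv k (\<lambda>y. complex_of_real (\<kappa> 0 (x - y))) y))\<^sup>2)) \<le>
      B\<^sup>2 * H * (v k * A ^ (2 * k))" for k
  proof -
    have "(LINT y|lborel. (\<kappa> k (x - y))\<^sup>2) = (LINT y|lborel. (\<kappa> k y)\<^sup>2)"
      by (rule integral_reflect)
    also have "\<dots> \<le> (LINT y|lborel. (B * A ^ k)\<^sup>2 * (1 / (1 + y\<^sup>2)))"
    proof (rule integral_mono)
      show "integrable lborel (\<lambda>y. (\<kappa> k y)\<^sup>2)"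
        using l2[of k] integrable_reflect_iff[of "\<lambda>y. (\<kappa> k y)\<^sup>2" x] by (simp add: l2_def)
      show "integrable lborel (\<lambda>y. (B * A ^ k)\<^sup>2 * (1 / (1 + y\<^sup>2)))"
        by (intro integrable_mult_right integrable_inverse_1_plus_square)
      fix y
      have "\<bar>\<kappa> k y\<bar> * \<bar>\<kappa> k y\<bar> \<le> (B * A ^ k) * (B * A ^ k * (1 / (1 + y\<^sup>2)))"
        using bounded[of k y] by (intro mult_mono bounded bound) auto
      then show "(\<kappa> k y)\<^sup>2 \<le> (B * A ^ k)\<^sup>2 * (1 / (1 + y\<^sup>2))"
        by (simp add: power2_eq_square mult.assoc)
    qed
    also have "\<dots> = B\<^sup>2 * H * A ^ (2 * k)"
      unfolding H_def integral_mult_right_zero by (simp add: power_mult_distrib power_even_eq)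
    finally have "v k * (LINT y|lborel. (\<kappa> k (x - y))\<^sup>2) \<le> v k * (B\<^sup>2 * H * A ^ (2 * k))"
      by (intro mult_left_mono v)
    moreover have "v k * (LINT y|lborel. (\<kappa> k (x - y))\<^sup>2) \<ge> 0"
      by (intro mult_nonneg_nonneg v integral_nonneg_AE) auto
    ultimately show ?thesis unfolding nn by (simp add: mult_ac)
  qed
  note le = this
  have "summable (\<lambda>k. v k * (LINT y|lborel. (norm (nth_deriv k (\<lambda>y. complex_of_real (\<kappa> 0 (x - y))) y))\<^sup>2))"
    by (rule summable_comparison_test'[OF summable_mult[OF v(2), of "B\<^sup>2 * H"] le])
  moreover have "l2 (nth_deriv k (\<lambda>y. complex_of_real (\<kappa> 0 (x - y))))" for k
    unfolding eq by (rule l2_scale[OF l2])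
  ultimately show ?thesis
    unfolding smooth_sobolev_space_iff[OF smooth_reflected] by blast
qed

text \<open>Differentiating \<open>\<kappa> 0 (x - y)\<close> in \<open>y\<close> produces the sign
  \<open>(-1) ^ k\<close>; the \<open>k\<close> derivatives on \<open>f\<close> then join those on
  the kernel, which gives the order \<open>2 * k\<close>.\<close>

lemma sobolev_inner_reflected:
  assumes "smooth f" "cauchy_bc f"
  shows "sobolev_inner v f (\<lambda>y. complex_of_real (\<kappa> 0 (x - y))) =
    (\<Sum>k. (-1) ^ k * of_real (v k) * conv f (\<kappa> (2 * k)) x)"
proof -
  have "(LINT y|lborel. nth_deriv k f y * cnj (nth_deriv k (\<lambda>y. complex_of_real (\<kappa> 0 (x - y))) y)) =
      (-1) ^ k * conv f (\<kappa> (2 * k)) x" for k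
  proof -
    have "(LINT y|lborel. nth_deriv k f y * cnj (nth_deriv k (\<lambda>y. complex_of_real (\<kappa> 0 (x - y))) y)) =
       (LINT y|lborel. (-1) ^ k * (nth_deriv k f y * of_real (\<kappa> k (x - y))))"
      by (intro Bochner_Integration.integral_cong) (simp_all add: nth_deriv_reflected)
    also have "\<dots> = (-1) ^ k * conv (nth_deriv k f) (\<kappa> k) x"
      by (simp add: conv_def)
    finally show ?thesis by (simp add: conv_nth_deriv[OF assms] mult_2)
  qed
  then show ?thesis
    by (simp add: smooth_sobolev_inner[OF assms(1) smooth_reflected] mult_ac)
qed

end

end

subsection \<open>The eigenvalue equation\<close>

text \<open>Supplies the integrability hypothesis of \<open>approximate_identity\<close>, as a
  product of two L2 functions.\<close>

lemma l2_times_inverse_1_plus_square: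
  assumes "l2 q"
  shows "integrable lborel (\<lambda>y. norm (q (x - y)) * (1 / (1 + y\<^sup>2)))"
proof -
  have "l2 (\<lambda>y. complex_of_real (1 / (1 + (0 - y)\<^sup>2)))"
    by (rule l2_of_real_bounded_integrable[OF _ integrable_inverse_1_plus_square, of 1])
       (auto simp: abs_of_pos add_pos_nonneg)
  moreover have "l2 (\<lambda>y. q (x - y))"
    using assms integrable_reflect_iff[of "\<lambda>y. (norm (q y))\<^sup>2" x] by (auto simp: l2_def)
  ultimately have "integrable lborel (\<lambda>y. norm (q (x - y) * complex_of_real (1 / (1 + (0 - y)\<^sup>2))))"
    by (intro integrable_norm l2_mult_integrable)
  then show ?thesis
    unfolding norm_mult norm_of_real by (simp add: abs_of_pos add_pos_nonneg)
qed

lemma bounded_times_inverse_1_plus_square: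
  fixes q :: "real \<Rightarrow> complex"
  assumes "q \<in> borel_measurable borel" "\<And>y. norm (q y) \<le> M"
  shows "integrable lborel (\<lambda>y. norm (q (x - y)) * (1 / (1 + y\<^sup>2)))"
  using integrable_norm[OF conv_bounded_integrable'[OF assms integrable_inverse_1_plus_square, of x]]
  unfolding norm_mult norm_of_real by (simp add: abs_of_pos add_pos_nonneg)

text \<open>The difference of the two integrands is the derivative of
  \<open>nth_deriv 1 f x * cnj (g x)\<close>, which vanishes at both ends. Treating it as a whole
  avoids asking that the products of \<open>f''\<close> with \<open>g\<close> and of
  \<open>f'\<close> with \<open>g'\<close> be integrable separately.\<close>

lemma integral_schroedinger_op:
  assumes f: "smooth f" "cauchy_bc f" and g: "smooth g" "cauchy_bc g" "l2 g" and V: "continuous_on UNIV V"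
    and op: "l2 (schroedinger_op V f)" and form: "integrable lebesgue (schroedinger_integrand V f g)"
  shows "(LINT x|lborel. schroedinger_op V f x * cnj (g x)) = schroedinger_form V f g"
proof -
  have deriv: "(nth_deriv k h has_vector_derivative nth_deriv (Suc k) h x) (at x)" if "smooth h" for h k x
    by (rule smooth_has_vector_derivative[OF that])
  have cont: "continuous_on UNIV (nth_deriv k f)" "continuous_on UNIV (nth_deriv k g)" "continuous_on UNIV g"
    "continuous_on UNIV f" for k
    using smooth_continuous_on[OF f(1)] smooth_continuous_on[OF g(1)]
      smooth_continuous_on[OF g(1), of UNIV 0] smooth_continuous_on[OF f(1), of UNIV 0] by auto
  have cont_form: "continuous_on UNIV (schroedinger_integrand V f g)"
    unfolding schroedinger_integrand_def[abs_def]
    by (intro continuous_intros continuous_on_cnj cont V)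
  have int: "integrable lborel (schroedinger_integrand V f g)"
    "integrable lborel (\<lambda>x. schroedinger_op V f x * cnj (g x))"
    using form l2_mult_integrable[OF op l2_cnj[OF g(3)]]
    by (auto simp: lebesgue_integrable_iff_lborel[OF cont_form])
  have lim: "((\<lambda>x. nth_deriv 1 f x * cnj (nth_deriv 0 g x)) \<longlongrightarrow> 0) F" if "F = at_top \<or> F = at_bot" for F
  proof (rule tendsto_mult_zero)
    show "(nth_deriv 1 f \<longlongrightarrow> 0) F"
      using f(2) that unfolding cauchy_bc_def by blast
    have "(nth_deriv 0 g \<longlongrightarrow> 0) F"
      using g(2) that unfolding cauchy_bc_def by blast
    from tendsto_cnj[OF this] show "((\<lambda>x. cnj (nth_deriv 0 g x)) \<longlongrightarrow> 0) F"
      by (simp only: complex_cnj_zero)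
  qed
  have "(LINT x|lborel. schroedinger_integrand V f g x - schroedinger_op V f x * cnj (g x)) = 0"
  proof (rule integral_derivative_eq_0[OF _ _ _ lim lim])
    fix x
    have "((\<lambda>x. nth_deriv 1 f x * cnj (nth_deriv 0 g x)) has_vector_derivative
        nth_deriv 1 f x * cnj (nth_deriv 1 g x) + nth_deriv 2 f x * cnj (nth_deriv 0 g x)) (at x)"
      using has_vector_derivative_mult[OF deriv[OF f(1), of 1 x] has_vector_derivative_cnj[OF deriv[OF g(1), of 0 x]]]
      by (simp only: numeral_2_eq_2 One_nat_def)
    moreover have "nth_deriv 1 f x * cnj (nth_deriv 1 g x) + nth_deriv 2 f x * cnj (nth_deriv 0 g x) =
        schroedinger_integrand V f g x - schroedinger_op V f x * cnj (g x)"
      by (simp add: schroedinger_integrand_def schroedinger_op_def algebra_simps)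
    ultimately show "((\<lambda>x. nth_deriv 1 f x * cnj (nth_deriv 0 g x)) has_vector_derivative
        schroedinger_integrand V f g x - schroedinger_op V f x * cnj (g x)) (at x)" by simp
  next
    show "continuous_on UNIV (\<lambda>x. schroedinger_integrand V f g x - schroedinger_op V f x * cnj (g x))"
      unfolding schroedinger_op_def by (intro continuous_intros continuous_on_cnj cont_form cont V)
  qed (use int in auto)
  then show ?thesis
    using int by (simp add: schroedinger_form_def lebesgue_integral_eq_lborel[OF cont_form])
qed

theorem theorem9:
  fixes v :: "nat \<Rightarrow> real" and V :: "real \<Rightarrow> real"
    and \<phi> :: "nat \<Rightarrow> real \<Rightarrow> complex" and l :: "nat \<Rightarrow> complex"
  assumes v_nonneg: "\<And>k. v k \<ge> 0"
    and v_summable: "\<And>x::real. summable (\<lambda>k. v k * x ^ (2 * k))"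
    and v_pos: "\<And>x::real. (\<Sum>k. v k * x ^ (2 * k)) > 0"
    and V_cont: "continuous_on UNIV V"
    and phi_smooth: "\<And>n. smooth (\<phi> n)"
    and phi_bc: "\<And>n. cauchy_bc (\<phi> n)"
    and phi_op: "\<And>n. square_integrable (schroedinger_op V (\<phi> n))"
    and phi_series: "\<And>n a b. uniformly_convergent_on {a..b}
                       (\<lambda>N x. \<Sum>k<N. sobolev_op_term v (\<phi> n) k x)"
    and phi_basis: "complete_orthonormal_basis v \<phi>"
    and form_integrable: "\<And>m n. integrable lebesgue (schroedinger_integrand V (\<phi> m) (\<phi> n))"
    and form_orthogonal: "\<And>m n. schroedinger_form V (\<phi> m) (\<phi> n) = (if m = n then l m else 0)"
  shows "\<forall>m. is_eigenvalue v V (l m) \<and> is_eigenfunction v V (l m) (\<phi> m)"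
proof
  fix m
  define f where "f = \<phi> m"
  define G where "G = schroedinger_op V f"
  define P where "P N x = (\<Sum>k<N. sobolev_op_term v f k x)" for N x
  define S where "S x = (\<Sum>k. sobolev_op_term v f k x)" for x
  have f: "smooth f" "cauchy_bc f"
    by (simp_all add: f_def phi_smooth phi_bc)
  have mem: "\<phi> n \<in> sobolev_space v" for n
    using phi_basis by (simp add: complete_orthonormal_basis_def)
  \<comment> \<open>At 0 only the term \<open>k = 0\<close> remains, since \<open>0 ^ 0 = 1\<close>,
    and positivity of the sum becomes \<open>v 0 > 0\<close>. This puts the basis functions in
    L2.\<close>
  have v0: "v 0 > 0"
  proof -
    have "(\<Sum>k. v k * 0 ^ (2 * k)) = (\<Sum>k\<in>{0}. v k * 0 ^ (2 * k))"
      by (rule suminf_finite) auto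
    then show ?thesis using v_pos[of 0] by simp
  qed
  have l2_phi: "l2 (\<phi> n)" for n
    using mem[of n] v0 by (auto simp: smooth_sobolev_space_iff phi_smooth dest: spec[of _ 0])
  then have l2_f: "l2 f" by (simp add: f_def)
  have cont_f: "continuous_on UNIV f"
    using smooth_continuous_on[OF f(1), of UNIV 0] by simp
  have cont_G: "continuous_on UNIV G"
    unfolding G_def schroedinger_op_def[abs_def] by (intro continuous_intros smooth_continuous_on f V_cont cont_f)
  have G: "l2 G"
    using phi_op[of m] by (simp add: square_integrable_iff_l2[OF cont_G, symmetric]) (simp add: G_def f_def)
  have coeff: "(LINT x|lborel. G x * cnj (\<phi> n x)) = (if m = n then l m else 0)" for n
    using integral_schroedinger_op[OF f phi_smooth phi_bc l2_phi V_cont, of n] G form_integrable[of m n]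
      form_orthogonal[of m n] by (simp add: G_def f_def)
  have cont_P: "continuous_on A (P N)" for N A
    unfolding P_def[abs_def] sobolev_op_term_def by (intro continuous_intros smooth_continuous_on f)
  have unif: "uniform_limit {a..b} P S sequentially" for a b
  proof -
    have "uniformly_convergent_on {a..b} P"
      using phi_series[of a b m] by (simp add: P_def[abs_def] f_def)
    moreover have "lim (\<lambda>N. P N x) = S x" for x
      unfolding P_def S_def suminf_eq_lim ..
    ultimately show ?thesis
      by (simp add: uniformly_convergent_uniform_limit_iff)
  qed
  \<comment> \<open>Uniform convergence on the degenerate interval \<open>{x..x}\<close> is
    convergence at \<open>x\<close>.\<close>
  have PS: "(\<lambda>N. P N x) \<longlonglongrightarrow> S x" for x
    using tendsto_uniform_limitI[OF unif[of x x]] by simp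
  have summable: "summable (\<lambda>k. sobolev_op_term v f k x)" for x
    unfolding summable_iff_convergent using PS[of x] by (auto simp: convergent_def P_def)
  have cont_S: "continuous_on UNIV S"
    unfolding continuous_on_eq_continuous_at[OF open_UNIV]
  proof
    fix x :: real
    have "continuous_on {x-1..x+1} S"
      by (rule uniform_limit_theorem[OF _ unif]) (auto intro!: always_eventually cont_P)
    then show "isCont S x"
      by (rule continuous_on_interior) auto
  qed
  define \<kappa> where "\<kappa> k y = Re (fejer_fourier k y)" for k y
  define c where "c = (LINT y|lborel. \<kappa> 0 y)"
  have c: "c > 0" unfolding c_def \<kappa>_def by (rule integral_fejer_pos)
  have base: "decaying_kernel \<kappa> 4 3"
    using decaying_kernel_fejer by (simp add: \<kappa>_def[abs_def])
  \<comment> \<open>\<open>K n k\<close> is the \<open>k\<close>-th derivative of the dilated kernel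
    \<open>K n 0\<close>. The factor is \<open>Suc n\<close> because
    \<open>decaying_kernel.scaled\<close> requires a dilation by at least 1.\<close>
  define K where "K n k y = real (Suc n) ^ Suc k * \<kappa> k (real (Suc n) * y)" for n k y
  have K: "decaying_kernel (K n) (real (Suc n) * 4) (real (Suc n) * 3)" for n
    unfolding K_def[abs_def] by (rule decaying_kernel.scaled[OF base]) simp
  have approx: "(\<lambda>n. conv q (K n 0) x) \<longlonglongrightarrow> q x * of_real c"
    if "continuous_on UNIV q" "integrable lborel (\<lambda>y. norm (q (x - y)) * (1 / (1 + y\<^sup>2)))" for q x
    using decaying_kernel.approximate_identity[OF base that] by (simp add: K_def[abs_def] c_def)
  have summable_v: "summable (\<lambda>k. v k * (real (Suc n) * 4) ^ (2 * k))" for n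
    by (rule v_summable)
  note kernel = decaying_kernel.measurable[OF K] decaying_kernel.integrable[OF K] decaying_kernel.bounded[OF K]
  define W where "W n x = (\<Sum>k. (-1) ^ k * of_real (v k) * conv f (K n (2 * k)) x)" for n x
  \<comment> \<open>The test function is the kernel translated to \<open>x\<close>. Being real, it
    is unaffected by the conjugation, and the left side becomes a convolution.\<close>
  have weak: "conv G (K n 0) x = l m * W n x" for n x
  proof -
    have "(LINT y|lborel. G y * cnj (complex_of_real (K n 0 (x - y)))) =
        l m * sobolev_inner v (\<phi> m) (\<lambda>y. complex_of_real (K n 0 (x - y)))"
      by (rule weak_equation[OF v_nonneg phi_basis phi_smooth v0 G coeff decaying_kernel.smooth_reflected[OF K]
          decaying_kernel.reflected_sobolev_space[OF K v_nonneg summable_v]])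
    then show ?thesis
      using decaying_kernel.sobolev_inner_reflected[OF K f]
      by (simp add: conv_def W_def f_def)
  qed
  have partial: "(\<lambda>N. conv (P N) (K n 0) x) \<longlonglongrightarrow> W n x" for n x
    using summable_LIMSEQ[OF decaying_kernel.conv_series_summable[OF K f l2_f v_nonneg summable_v, of n x]]
    unfolding W_def P_def[abs_def] decaying_kernel.conv_partial_eq[OF K f] decaying_kernel.conv_partial_def[OF K] .
  have "G x = l m * S x" for x
  proof (cases "l m = 0")
    case True
    then have "(\<lambda>n. conv G (K n 0) x) = (\<lambda>_. 0)" by (simp add: weak)
    then have "(\<lambda>_. 0) \<longlonglongrightarrow> G x * of_real c"
      using approx[OF cont_G l2_times_inverse_1_plus_square[OF G], of x] by simp
    then show ?thesis using True c by (simp add: LIMSEQ_const_iff)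
  next
    case False
    \<comment> \<open>Normalised so that \<open>conv g (K n 0)\<close> is \<open>W n\<close>, the
      limit of the convolved partial sums, whose norms it therefore bounds.\<close>
    define g where "g x = 1 / l m * G x" for x
    have g: "l2 g" "continuous_on UNIV g"
      unfolding g_def[abs_def] by (intro l2_scale G continuous_intros cont_G)+
    have conv_g: "conv g (K n 0) x = W n x" for n x
    proof -
      have "conv g (K n 0) x = 1 / l m * conv G (K n 0) x"
        unfolding conv_def g_def mult.assoc by (rule integral_mult_right_zero)
      then show ?thesis using False by (simp add: weak)
    qed
    \<comment> \<open>Dilation preserves the L1 norm, so \<open>D\<close> serves for every
      \<open>K n 0\<close>, and \<open>M\<close> depends neither on \<open>n\<close> nor on
      \<open>N\<close>. The summand 1 makes \<open>D\<close> positive.\<close>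
    define D where "D = (LINT y|lborel. \<bar>\<kappa> 0 y\<bar>) + 1"
    define M where "M = D\<^sup>2 * (LINT y|lborel. (norm (g y))\<^sup>2)"
    have D: "D > 0"
      unfolding D_def by (intro add_nonneg_pos integral_nonneg_AE) auto
    have D_bound: "(LINT y|lborel. \<bar>K n 0 y\<bar>) \<le> D" for n
      using lborel_integral_real_affine[of "real (Suc n)" "\<lambda>y. \<bar>\<kappa> 0 y\<bar>" 0]
      by (simp add: K_def D_def abs_mult del: of_nat_Suc)
    have conv_bound: "(LINT x|lborel. (norm (conv (P N) (K n 0) x))\<^sup>2) \<le> M" for n N
    proof -
      have "(LINT x|lborel. (norm (conv (P N) (K n 0) x))\<^sup>2) \<le> (LINT x|lborel. (norm (conv g (K n 0) x))\<^sup>2)"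
        using decaying_kernel.conv_partial_norm_le[OF K f l2_f v_nonneg summable_v, of n "W n" N] partial
        by (simp add: P_def[abs_def] decaying_kernel.conv_partial_eq[OF K f] conv_g)
      also have "\<dots> \<le> M"
        unfolding M_def by (rule conv_l2(2)[OF g(1) kernel D_bound D])
      finally show ?thesis .
    qed
    have conv_l2: "l2 (conv (P N) (K n 0))" for n N
      using decaying_kernel.l2_conv_partial[OF K l2_f]
      by (simp add: P_def[abs_def] decaying_kernel.conv_partial_eq[OF K f])
    \<comment> \<open>\<open>P N\<close> is not yet known to be in L2, so the approximate identity
      is applied to it by virtue of boundedness, which follows from continuity and the decay of the
      derivatives of \<open>f\<close>.\<close>
    obtain R where R: "norm (P N x) \<le> R N" for N x
    proof -
      have "\<exists>R. \<forall>x. norm (P N x) \<le> R" for N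
      proof -
        have "(P N \<longlongrightarrow> 0) F" if "\<And>k. (nth_deriv k f \<longlongrightarrow> 0) F" for F
          unfolding P_def[abs_def] sobolev_op_term_def
          by (intro tendsto_null_sum tendsto_mult_right_zero that)
        then show ?thesis
          using continuous_tendsto_0_bounded[OF cont_P] f(2) unfolding cauchy_bc_def by metis
      qed
      then show ?thesis using that by metis
    qed
    have P_approx: "(\<lambda>n. conv (P N) (K n 0) x) \<longlonglongrightarrow> P N x * of_real c" for N x
      by (intro approx cont_P bounded_times_inverse_1_plus_square[OF borel_measurable_continuous[OF cont_P] R])
    \<comment> \<open>With \<open>N\<close> fixed the kernels shrink to a point, and Fatou carries
      the bound \<open>M\<close> over to \<open>P N\<close> times \<open>c\<close>, uniformly in
      \<open>N\<close>.\<close>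
    note Pc = fatou_l2[OF conv_l2 conv_bound P_approx]
    have P_l2: "l2 (P N)" for N
      using l2_scale[OF Pc(1)[of N], of "1 / of_real c"] c by simp
    have P_bound: "(LINT x|lborel. (norm (P N x))\<^sup>2) \<le> M / c\<^sup>2" for N
      using Pc(2)[of N] c by (simp add: norm_mult power_mult_distrib pos_le_divide_eq)
    note S_l2 = fatou_l2(1)[OF P_l2 P_bound PS]
    \<comment> \<open>Now \<open>n\<close> is fixed and \<open>N\<close> grows: the uniform L2 bound
      takes the limit inside the convolution, so both sides are limits of
      \<open>conv (P N) (K n 0) x\<close>.\<close>
    have "conv S (K n 0) x = conv g (K n 0) x" for n
      using LIMSEQ_unique[OF conv_l2_bounded_limit[OF P_l2 P_bound PS kernel] partial]
      by (simp add: conv_g)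
    \<comment> \<open>Shrinking the kernels once more recovers the values of the continuous L2
      functions \<open>S\<close> and \<open>g\<close> at \<open>x\<close>.\<close>
    then have "S x * of_real c = g x * of_real c"
      using LIMSEQ_unique[OF approx[OF cont_S l2_times_inverse_1_plus_square[OF S_l2]]]
        approx[OF g(2) l2_times_inverse_1_plus_square[OF g(1)], of x] by simp
    then have "S x = g x" using c by simp
    then show ?thesis using False by (simp add: g_def)
  qed
  \<comment> \<open>The zero function has \<open>sobolev_inner\<close> 0 with itself, whereas
    orthonormality demands 1.\<close>
  moreover have "\<exists>x. f x \<noteq> 0"
  proof (rule ccontr)
    assume "\<not> ?thesis"
    then have "f = (\<lambda>_. 0)" by auto
    then have "nth_deriv k f = (\<lambda>_. 0)" for k
      using nth_deriv_eqI[of "\<lambda>_ _. 0" f] by simp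
    then have "sobolev_inner v f f = 0"
      by (simp add: sobolev_inner_def)
    then show False
      using phi_basis by (simp add: complete_orthonormal_basis_def f_def)
  qed
  ultimately have "is_eigenfunction v V (l m) f"
    unfolding is_eigenfunction_def using f summable by (auto simp: G_def S_def)
  then show "is_eigenvalue v V (l m) \<and> is_eigenfunction v V (l m) (\<phi> m)"
    unfolding is_eigenvalue_def f_def by blast
qed

end
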